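(* Assume each $f_i$ ($i\in\mathcal V$) is $L_i$-smooth with $L_i>0$ and $\mu_i$-strongly convex with $\mu_i\ge 0$, $\sum_{i=1}^m\mu_i>0$; that the graph sequence $\{\mathcal G(k)\}_{k\ge0}$ is uniformly strongly connected with constant $\tilde B$; and that the weights $a_{li}(k)$ obey the weight generation rule with parameter $c_0\in(0,1/m)$. Let $x^*$ be the unique minimizer of $f=\frac1m\sum_{i=1}^m f_i$ over $\mathbb R^d$. Let $\alpha>0$, $\beta>0$, $B=2\tilde B-1$, $\sigma=c_0^{\,2+mB}$, $\epsilon=2m\frac{1+\sigma^{-mB}}{1-\sigma^{mB}}$, and let $B_0\ge B$ be an integer such that $\varepsilon:=\epsilon(1-\sigma^{mB})^{(B_0-1)/(mB)}<1$. Put $$C_1=2\sqrt{\frac{(1+\beta)m\hat L}{\beta\bar\mu}+\frac{\alpha m\hat\mu}{\bar\mu}},$$ $$C_2=2B_0\kappa\,\epsilon\,\|W^{-1}\|_{\max}^{1}\,\bigl(\varepsilon+\epsilon(B_0-1)\bigr)(1+\sqrt m)(1+\alpha^{-1})(1+C_1),$$ where $\|W^{-1}\|_{\max}^1=\sup_{k\ge1}\|W(k)^{-1}\|_{\max}$, and $$\theta_0=\sqrt[B_0]{\frac{\varepsilon+\sqrt{C_2(C_2-\varepsilon^2+1)}}{1+C_2}}.$$ If the fixed step-size $\eta$ satisfies $$\eta\in\left(0,\ \min\left\{\frac{(1+\alpha^{-1})(1-\varepsilon)^2}{\bar\mu C_2},\ \frac{1}{(1+\beta)\bar L}\right\}\right),$$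 then the algorithm converges to $x^*$ at the linear rate $\mathcal O(\theta^k)$ for some $\theta$ with $\theta_0\le\theta<1$; that is, there is a constant $C$ (independent of $k$) with $\|\mathbf x(k)-\mathbf 1{x^*}^T\|_{\mathrm F}\le C\,\theta^k$ for all $k\ge1$.
   Context: Problem. There are $m$ agents $\mathcal V=\{1,\dots,m\}$; agent $i$ has a differentiable function $f_i:\mathbb R^d\to\mathbb R$. They minimize $f(x)=\frac1m\sum_{i=1}^m f_i(x)$ over $x\in\mathbb R^d$. Graphs. $\mathcal G(k)=(\mathcal V,\mathcal E(k))$, $k=0,1,\dots$, are directed graphs; $(i,j)\in\mathcal E(k)$ iff agent $i$ can receive information from agent $j$ at iteration $k$. $\mathcal N_i^{\mathrm{out}}(k)=\{l\ne i:(l,i)\in\mathcal E(k)\}$ and $d_i^{\mathrm{out}}(k)=|\mathcal N_i^{\mathrm{out}}(k)|$. Uniformly strongly connected with constant $\tilde B$ (a positive integer) means: for every integer $t\ge0$ the graph $\bigl(\mathcal V,\bigcup_{l=t\tilde B}^{t\tilde B+\tilde B-1}\mathcal E(l)\bigr)$ is strongly connected. Weight generation rule. With $0<c_0<1/m$ fixed: at $k=0$, $a_{li}(0)$ is any real number for $l\in\mathcal N_i^{\mathrm{out}}(0)$; at $k\ge1$, $a_{li}(k)\in\left[c_0,\frac{1-c_0}{d_i^{\mathrm{out}}(k)}\right]$ for $l\in\mathcal N_i^{\mathrm{out}}(k)$; for all $k\ge 0$, $a_{li}(k)=0$ for $l\notin\mathcal N_i^{\mathrm{out}}(k)\cup\{i\}$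 and $a_{ii}(k)=1-\sum_{l\ne i}a_{li}(k)$. (The weights are randomly chosen subject to these constraints; the result is for any such choice.) Algorithm (encryption/decryption of the exchanged messages does not alter the updates). Initialization: $y_i(0)=x_i(0)\in\mathbb R^d$ arbitrary, $w_i(0)\in\mathbb R$ arbitrary, $s_i(0)=\nabla f_i(x_i(0))$. For $k\ge0$, with step-size $\eta>0$: $y_i(k+1)=\sum_{j=1}^m a_{ij}(k)\bigl(y_j(k)-\eta s_j(k)\bigr)$; $w_i(k+1)=\sum_{j=1}^m a_{ij}(k)w_j(k)$, except that $w_i(1)$ is reset to $1$ for every $i$; $x_i(k+1)=y_i(k+1)/w_i(k+1)$ (so $x_i(1)=y_i(1)$); $s_i(k+1)=\sum_{j=1}^m a_{ij}(k)s_j(k)+\nabla f_i(x_i(k+1))-\nabla f_i(x_i(k))$. Notation. $\mathbf x(k)=[x_1(k),\dots,x_m(k)]^T\in\mathbb R^{m\times d}$, $W(k)=\mathrm{diag}\{w_1(k),\dots,w_m(k)\}$, $\mathbf 1$ is the all-ones column vector, $\|\cdot\|_{\mathrm F}$ the Frobenius norm, $\|M\|_{\max}=\max_{ij}|M_{ij}|$. $L_i$-smooth: $\|\nabla f_i(x)-\nabla f_i(y)\|_2\le L_i\|x-y\|_2$ for all $x,y$. $\mu_i$-strongly convex: $f_i(y)\ge f_i(x)+\nabla f_i(x)^T(y-x)+\frac{\mu_i}{2}\|y-x\|_2^2$ for all $x,y$ (with $\mu_i=0$ allowed). $\hat L=\max_iL_i$, $\bar L=\frac1m\sum_iL_i$,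 $\hat\mu=\max_i\mu_i$, $\bar\mu=\frac1m\sum_i\mu_i$, $\kappa=\hat L/\bar\mu$. *)

theory Defs
  imports "HOL-Analysis.Analysis"
begin

definition gradient :: "('a::euclidean_space \<Rightarrow> real) \<Rightarrow> 'a \<Rightarrow> 'a" where
  "gradient f x = (THE D. GDERIV f x :> D)"

definition smooth_with :: "real \<Rightarrow> ('a::euclidean_space \<Rightarrow> real) \<Rightarrow> bool" where
  "smooth_with L f \<longleftrightarrow> (\<forall>x y. norm (gradient f x - gradient f y) \<le> L * norm (x - y))"

text \<open>The modulus 0 is allowed and gives plain convexity.\<close>

definition strongly_convex_with :: "real \<Rightarrow> ('a::euclidean_space \<Rightarrow> real) \<Rightarrow> bool" where
  "strongly_convex_with \<mu> f \<longleftrightarrow>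
     (\<forall>x y. f y \<ge> f x + gradient f x \<bullet> (y - x) + \<mu> / 2 * (norm (y - x))\<^sup>2)"

text \<open>
  The agents are the elements of a finite type. A directed graph on the agents is its edge set;
  an edge \<open>(i, j)\<close> means that \<open>i\<close> can receive information from \<open>j\<close>.
\<close>

definition out_neighbours :: "('v \<times> 'v) set \<Rightarrow> 'v \<Rightarrow> 'v set" where
  "out_neighbours E i = {l. l \<noteq> i \<and> (l, i) \<in> E}"

definition strongly_connected :: "('v \<times> 'v) set \<Rightarrow> bool" where
  "strongly_connected E \<longleftrightarrow> (\<forall>u v. (u, v) \<in> E\<^sup>*)"

definition uniformly_strongly_connected :: "nat \<Rightarrow> (nat \<Rightarrow> ('v \<times> 'v) set) \<Rightarrow> bool" where
  "uniformly_strongly_connected b E \<longleftrightarrow>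
     b > 0 \<and> (\<forall>t. strongly_connected (\<Union>l\<in>{t * b..<t * b + b}. E l))"

text \<open>
  \<open>a k $ l $ i\<close> is the weight that agent \<open>i\<close> assigns to agent \<open>l\<close> at iteration \<open>k\<close>.
  The off-diagonal weights on edges are unrestricted at iteration 0.
\<close>

definition weight_rule ::
  "real \<Rightarrow> (nat \<Rightarrow> ('v::finite \<times> 'v) set) \<Rightarrow> (nat \<Rightarrow> real^'v^'v) \<Rightarrow> bool" where
  "weight_rule c0 E a \<longleftrightarrow>
     (\<forall>k\<ge>1. \<forall>i. \<forall>l\<in>out_neighbours (E k) i.
        a k $ l $ i \<in> {c0..(1 - c0) / real (card (out_neighbours (E k) i))}) \<and>
     (\<forall>k i l. l \<notin> out_neighbours (E k) i \<union> {i} \<longrightarrow> a k $ l $ i = 0) \<and>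
     (\<forall>k i. a k $ i $ i = 1 - (\<Sum>l\<in>UNIV - {i}. a k $ l $ i))"

text \<open>
  \<open>x k\<close>, \<open>y k\<close>, \<open>s k\<close> are matrices whose row \<open>$ i\<close> is the vector held by agent \<open>i\<close>.
  The values \<open>y 0\<close> and \<open>w 0\<close> are arbitrary, and \<open>w 1\<close> is reset to the all-ones vector.
\<close>

definition algorithm_run ::
  "('v::finite \<Rightarrow> real^'d \<Rightarrow> real) \<Rightarrow> (nat \<Rightarrow> real^'v^'v) \<Rightarrow> real \<Rightarrow>
   (nat \<Rightarrow> real^'d^'v) \<Rightarrow> (nat \<Rightarrow> real^'d^'v) \<Rightarrow> (nat \<Rightarrow> real^'v) \<Rightarrow> (nat \<Rightarrow> real^'d^'v) \<Rightarrow> bool" where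
  "algorithm_run f a \<eta> x y w s \<longleftrightarrow>
     (\<forall>i. y 0 $ i = x 0 $ i) \<and>
     (\<forall>i. s 0 $ i = gradient (f i) (x 0 $ i)) \<and>
     (\<forall>k i. y (Suc k) $ i = (\<Sum>j\<in>UNIV. (a k $ i $ j) *\<^sub>R (y k $ j - \<eta> *\<^sub>R (s k $ j)))) \<and>
     (\<forall>k i. w (Suc k) $ i = (if k = 0 then 1 else (\<Sum>j\<in>UNIV. a k $ i $ j * w k $ j))) \<and>
     (\<forall>k i. x (Suc k) $ i = (y (Suc k) $ i) /\<^sub>R (w (Suc k) $ i)) \<and>
     (\<forall>k i. s (Suc k) $ i = (\<Sum>j\<in>UNIV. (a k $ i $ j) *\<^sub>R (s k $ j))
        + gradient (f i) (x (Suc k) $ i) - gradient (f i) (x k $ i))"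

definition diag_mat :: "real^'v \<Rightarrow> real^'v^'v" where
  "diag_mat v = (\<chi> i j. if i = j then v $ i else 0)"

definition max_norm :: "real^'n^'m \<Rightarrow> real" where
  "max_norm M = Max {\<bar>M $ i $ j\<bar> | i j. True}"

definition frobenius_norm :: "real^'n^'m \<Rightarrow> real" where
  "frobenius_norm M = sqrt (\<Sum>i\<in>UNIV. \<Sum>j\<in>UNIV. (M $ i $ j)\<^sup>2)"

lemma frobenius_norm_eq_norm: "frobenius_norm M = norm M"
  by (simp add: frobenius_norm_def norm_vec_def L2_set_def sum_nonneg)

end

theory Submission
  imports Defs
begin

text \<open>
  Multiplying the weights over \<open>m B\<close> iterations gives a matrix with all entries at least \<open>c0 ^ (m B)\<close>,
  because the set of agents reached from a given one grows over every \<open>B\<close> iterations. In the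
  coordinates \<open>x = W\<inverse> y\<close> and \<open>h = W\<inverse> s\<close> the updates are perturbed row-stochastic mixings, so over such
  a window the diameters of the agents' \<open>x\<close>- and \<open>h\<close>-values shrink by the factor \<open>1 - q\<close>,
  where \<open>q = \<sigma> ^ (m B)\<close>, up to perturbations. The perturbation of \<open>x\<close> is \<open>\<eta>\<close> times the diameter of \<open>h\<close>, and that of \<open>h\<close>
  is at most \<open>2 Winv Lhat\<close> times the movement of \<open>x\<close>. Since the weights preserve column sums, the
  mean of \<open>y\<close> performs a gradient step for the averaged objective, whose error is controlled by the diameter of
  \<open>x\<close>. The three quantities satisfy a positive linear recursion. It contracts in a weighted maximum
  norm because the bound on \<open>\<eta>\<close> contains the factor \<open>(B0 \<epsilon>)\<^sup>2\<close>, which dominates \<open>(2 m B / q)\<^sup>2\<close>.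
\<close>

subsection \<open>Mixing and diameters\<close>

text \<open>Disagreement is measured by a diameter because it refers to no particular average, and
  averaging with any row-stochastic weights cannot increase it.\<close>

abbreviation spread :: "('v::finite \<Rightarrow> 'a::real_normed_vector) \<Rightarrow> real" where
  "spread z \<equiv> diameter (range z)"

lemma norm_diff_le_spread: "norm (z i - z j) \<le> spread z"
  using diameter_bounded_bound[of "range z" "z i" "z j"] by (simp add: finite_imp_bounded dist_norm)

lemma spread_leI: "(\<And>i j. norm (z i - z j) \<le> d) \<Longrightarrow> spread z \<le> d"
  by (rule diameter_le) auto

lemma spread_nonneg: "spread z \<ge> 0"
  using norm_diff_le_spread[of z undefined undefined] by simp

lemma spread_add_le: "spread (\<lambda>i. y i + z i) \<le> spread y + spread z"
proof (rule spread_leI)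
  fix i j
  have "norm ((y i + z i) - (y j + z j)) \<le> norm (y i - y j) + norm (z i - z j)"
    by (metis add_diff_add norm_triangle_ineq)
  then show "norm ((y i + z i) - (y j + z j)) \<le> spread y + spread z"
    using norm_diff_le_spread[of y i j] norm_diff_le_spread[of z i j] by linarith
qed

lemma spread_scaleR_le: "spread (\<lambda>i. c *\<^sub>R z i) \<le> \<bar>c\<bar> * spread z"
  by (rule spread_leI)
    (simp add: scaleR_diff_right[symmetric] mult_left_mono norm_diff_le_spread)

text \<open>Multiplying the difference by \<open>c\<close> couples the two weightings: it becomes
  the sum of \<open>(p i * q j) *\<^sub>R (z i - z j)\<close> over all pairs, with total mass
  \<open>c * c\<close>. The mass \<open>c\<close> is arbitrary because rows with a common part
  removed no longer sum to 1.\<close>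

lemma norm_weighted_diff_le_spread:
  fixes z :: "'v::finite \<Rightarrow> 'a::real_normed_vector"
  assumes p: "\<And>i. p i \<ge> 0" "sum p UNIV = c" and q: "\<And>i. q i \<ge> 0" "sum q UNIV = c"
  shows "norm ((\<Sum>i\<in>UNIV. p i *\<^sub>R z i) - (\<Sum>i\<in>UNIV. q i *\<^sub>R z i)) \<le> c * spread z"
    (is "norm ?d \<le> _")
proof (cases "c = 0")
  case True
  then have "p i = 0" "q i = 0" for i
    using p q by (simp_all add: sum_nonneg_eq_0_iff)
  then show ?thesis using True by simp
next
  case False
  have "c \<ge> 0" using p by (auto intro: sum_nonneg)
  have "c *\<^sub>R (\<Sum>i\<in>UNIV. p i *\<^sub>R z i) = (\<Sum>i\<in>UNIV. \<Sum>j\<in>UNIV. (p i * q j) *\<^sub>R z i)"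
    by (simp add: scaleR_left.sum[symmetric] sum_distrib_left[symmetric] q scaleR_right.sum mult.commute)
  moreover have "c *\<^sub>R (\<Sum>j\<in>UNIV. q j *\<^sub>R z j) = (\<Sum>i\<in>UNIV. \<Sum>j\<in>UNIV. (p i * q j) *\<^sub>R z j)"
    by (subst sum.swap)
      (simp add: scaleR_left.sum[symmetric] sum_distrib_right[symmetric] p scaleR_right.sum)
  ultimately have "c *\<^sub>R ?d = (\<Sum>i\<in>UNIV. \<Sum>j\<in>UNIV. (p i * q j) *\<^sub>R (z i - z j))"
    by (simp add: scaleR_diff_right sum_subtractf)
  also have "norm \<dots> \<le> (\<Sum>i\<in>UNIV. \<Sum>j\<in>UNIV. p i * q j * spread z)"
    by (intro sum_norm_le) (simp add: p q mult_left_mono norm_diff_le_spread)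
  also have "\<dots> = c * (c * spread z)"
    by (simp add: sum_distrib_right[symmetric] sum_distrib_left[symmetric] p q)
  finally show ?thesis using False \<open>c \<ge> 0\<close> by simp
qed

lemma norm_diff_mean_le_spread:
  fixes z :: "'v::finite \<Rightarrow> 'a::real_normed_vector"
  assumes "\<And>i. p i \<ge> 0" "sum p UNIV = 1"
  shows "norm ((\<Sum>i\<in>UNIV. p i *\<^sub>R z i) - z j) \<le> spread z"
proof -
  have "(\<Sum>i\<in>UNIV. (if i = j then 1 else 0) *\<^sub>R z i) = z j"
    by (simp add: if_distrib[of "\<lambda>c. c *\<^sub>R _"] cong: if_cong)
  then show ?thesis
    using norm_weighted_diff_le_spread[of p 1 "\<lambda>i. if i = j then 1 else 0" z] assms by simp
qed

text \<open>The push-sum change of coordinates: after division by the weights, mixing by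
  \<open>M\<close> averages the ratios, with coefficients that sum to 1 as soon as \<open>v'\<close>
  is the image of \<open>v\<close> under \<open>M\<close>.\<close>

lemma mixing_as_mean:
  fixes M :: "real^'v^'v" and v v' :: "real^'v" and u :: "'v::finite \<Rightarrow> 'a::real_normed_vector"
  assumes "\<And>i. v $ i > 0"
  shows "(\<Sum>j\<in>UNIV. M $ i $ j *\<^sub>R u j) /\<^sub>R v' $ i
    = (\<Sum>j\<in>UNIV. (M $ i $ j * v $ j / v' $ i) *\<^sub>R (u j /\<^sub>R v $ j))"
  unfolding scaleR_right.sum using less_imp_neq[OF assms]
  by (intro sum.cong refl) (simp add: field_simps)

text \<open>Contraction is Dobrushin's argument: removing the common part \<open>\<rho>\<close> from the rows leaves mass \<open>1 - m \<rho>\<close>.\<close>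

lemma spread_mixing_le:
  fixes M :: "real^'v^'v" and v v' :: "real^'v" and u :: "'v::finite \<Rightarrow> 'a::real_normed_vector"
  assumes v: "\<And>i. v $ i > 0" and v': "\<And>i. v' $ i > 0"
    and v'_eq: "\<And>i. v' $ i = (\<Sum>j\<in>UNIV. M $ i $ j * v $ j)"
    and \<rho>: "0 \<le> \<rho>" "\<And>i j. \<rho> * v' $ i \<le> M $ i $ j * v $ j"
  shows "spread (\<lambda>i. (\<Sum>j\<in>UNIV. M $ i $ j *\<^sub>R u j) /\<^sub>R v' $ i)
    \<le> (1 - \<rho>) * spread (\<lambda>i. u i /\<^sub>R v $ i)"
proof (rule spread_leI)
  fix i i'
  define z where "z = (\<lambda>i. u i /\<^sub>R v $ i)"
  define P where "P = (\<lambda>i j. M $ i $ j * v $ j / v' $ i - \<rho>)"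
  have nonneg: "P i j \<ge> 0" for i j
    using \<rho>(2)[of i j] v'[of i] by (simp add: P_def field_simps)
  have total: "sum (P i) UNIV = 1 - CARD('v) * \<rho>" for i
    using less_imp_neq[OF v'[of i]]
    by (simp add: P_def sum_subtractf sum_divide_distrib[symmetric] v'_eq[symmetric])
  have eq: "(\<Sum>j\<in>UNIV. M $ i $ j *\<^sub>R u j) /\<^sub>R v' $ i
      = (\<Sum>j\<in>UNIV. P i j *\<^sub>R z j) + \<rho> *\<^sub>R (\<Sum>j\<in>UNIV. z j)" for i
    unfolding mixing_as_mean[OF v]
    unfolding P_def z_def scaleR_right.sum sum.distrib[symmetric]
    by (simp only: scaleR_left_distrib[symmetric] diff_add_cancel)
  have "norm ((\<Sum>j\<in>UNIV. P i j *\<^sub>R z j) - (\<Sum>j\<in>UNIV. P i' j *\<^sub>R z j))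
      \<le> (1 - CARD('v) * \<rho>) * spread z"
    by (rule norm_weighted_diff_le_spread) (simp_all add: nonneg total)
  also have "\<dots> \<le> (1 - \<rho>) * spread z"
    using \<rho>(1) mult_right_mono[of 1 "real CARD('v)" \<rho>]
    by (intro mult_right_mono spread_nonneg) (simp add: Suc_leI)
  finally show "norm ((\<Sum>j\<in>UNIV. M $ i $ j *\<^sub>R u j) /\<^sub>R v' $ i
      - (\<Sum>j\<in>UNIV. M $ i' $ j *\<^sub>R u j) /\<^sub>R v' $ i') \<le> (1 - \<rho>) * spread (\<lambda>i. u i /\<^sub>R v $ i)"
    unfolding eq by (simp add: z_def)
qed

section \<open>Products of weight matrices, newest factor on the left\<close>

primrec transition :: "(nat \<Rightarrow> real^'v^'v) \<Rightarrow> nat \<Rightarrow> nat \<Rightarrow> real^'v^'v" where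
  "transition a k 0 = mat 1"
| "transition a k (Suc n) = a (k + n) ** transition a k n"

lemma transition_Suc_action:
  fixes u :: "'v::finite \<Rightarrow> 'a::real_vector"
  shows "(\<Sum>j\<in>UNIV. transition a k (Suc n) $ i $ j *\<^sub>R u j)
    = (\<Sum>l\<in>UNIV. a (k + n) $ i $ l *\<^sub>R (\<Sum>j\<in>UNIV. transition a k n $ l $ j *\<^sub>R u j))"
proof -
  have "(\<Sum>l\<in>UNIV. a (k + n) $ i $ l *\<^sub>R (\<Sum>j\<in>UNIV. transition a k n $ l $ j *\<^sub>R u j))
      = (\<Sum>j\<in>UNIV. \<Sum>l\<in>UNIV. (a (k + n) $ i $ l * transition a k n $ l $ j) *\<^sub>R u j)"
    unfolding scaleR_right.sum by (subst sum.swap) simp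
  then show ?thesis by (simp add: matrix_matrix_mult_def scaleR_left.sum)
qed

lemma transition_0_action:
  fixes u :: "'v::finite \<Rightarrow> 'a::real_vector"
  shows "(\<Sum>j\<in>UNIV. transition a k 0 $ i $ j *\<^sub>R u j) = u i"
  by (simp add: mat_def if_distrib[of "\<lambda>c. c *\<^sub>R _"] cong: if_cong)

lemma transition_action:
  fixes u :: "nat \<Rightarrow> 'v::finite \<Rightarrow> 'a::real_vector"
  assumes "\<And>t i. t \<ge> k \<Longrightarrow> u (Suc t) i = (\<Sum>j\<in>UNIV. a t $ i $ j *\<^sub>R u t j)"
  shows "u (k + n) i = (\<Sum>j\<in>UNIV. transition a k n $ i $ j *\<^sub>R u k j)"
proof (induction n arbitrary: i)
  case 0
  show ?case using transition_0_action[of a k i "u k"] by simp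
next
  case (Suc n)
  then show ?case using transition_Suc_action[of a k n i "u k"] assms[of "k + n"] by simp
qed

subsection \<open>Push-sum weights on time-varying graphs\<close>

text \<open>The recursion for \<open>w\<close> starts from the reset at iteration 1. Weights at
  iteration 0 may have any sign, so positivity is only claimed for \<open>k \<ge> 1\<close>.\<close>

locale push_sum =
  fixes c0 :: real and E :: "nat \<Rightarrow> ('v::finite \<times> 'v) set" and Bt :: nat
    and a :: "nat \<Rightarrow> real^'v^'v" and w :: "nat \<Rightarrow> real^'v"
  assumes c0: "0 < c0" "c0 < 1 / CARD('v)"
    and connected: "uniformly_strongly_connected Bt E"
    and weights: "weight_rule c0 E a"
    and w_1: "w 1 $ i = 1"
    and w_Suc: "k \<ge> 1 \<Longrightarrow> w (Suc k) $ i = (\<Sum>j\<in>UNIV. a k $ i $ j * w k $ j)"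
begin

text \<open>Each window of \<open>2 * Bt - 1\<close> iterations adds at least one agent to an
  incomplete reached set, so one window per agent suffices to reach all of them.\<close>

definition mixing_time :: nat where
  "mixing_time = CARD('v) * (2 * Bt - 1)"

lemma c0_lt_1: "c0 < 1"
proof -
  have "1 / real CARD('v) \<le> 1" by (simp add: Suc_leI)
  then show ?thesis using c0 by linarith
qed

lemma mixing_time_pos: "mixing_time > 0"
  using connected by (simp add: mixing_time_def uniformly_strongly_connected_def)

text \<open>The diagonal entry absorbs the rest of its column, also at iteration 0; the sum of the
  trackers \<open>s\<close> is therefore under control from the start.\<close>

lemma column_sum: "(\<Sum>l\<in>UNIV. a k $ l $ i) = 1"
proof -
  have "a k $ i $ i = 1 - (\<Sum>l\<in>UNIV - {i}. a k $ l $ i)"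
    using weights by (simp add: weight_rule_def)
  then show ?thesis by (simp add: sum.remove[of UNIV i])
qed

lemma edge_weight_ge:
  "k \<ge> 1 \<Longrightarrow> (l, i) \<in> E k \<Longrightarrow> l \<noteq> i \<Longrightarrow> a k $ l $ i \<ge> c0"
  using weights by (auto simp: weight_rule_def out_neighbours_def)

text \<open>The upper weight bound times the out-degree leaves at least \<open>c0\<close> on the
  diagonal. For an empty out-neighbourhood the off-diagonal sum is 0, which is also at most
  \<open>1 - c0\<close>.\<close>

lemma self_weight_ge:
  assumes "k \<ge> 1"
  shows "a k $ i $ i \<ge> c0"
proof -
  let ?N = "out_neighbours (E k) i"
  have off_edge: "a k $ l $ i = 0" if "l \<notin> ?N \<union> {i}" for l
    using weights that unfolding weight_rule_def by blast
  have "(\<Sum>l\<in>UNIV - {i}. a k $ l $ i) = (\<Sum>l\<in>?N. a k $ l $ i)"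
    using off_edge by (intro sum.mono_neutral_right) (auto simp: out_neighbours_def)
  also have "\<dots> \<le> (\<Sum>l\<in>?N. (1 - c0) / card ?N)"
    using weights assms by (intro sum_mono) (auto simp: weight_rule_def)
  also have "\<dots> \<le> 1 - c0"
    using c0_lt_1 by simp
  finally show ?thesis using weights by (simp add: weight_rule_def)
qed

lemma weight_nonneg:
  assumes "k \<ge> 1"
  shows "a k $ l $ i \<ge> 0"
proof (cases "l = i")
  case True
  then show ?thesis using self_weight_ge[OF assms, of i] c0 by simp
next
  case False
  then show ?thesis
    using edge_weight_ge[OF assms, of l i] c0 weights
    by (cases "(l, i) \<in> E k") (auto simp: weight_rule_def out_neighbours_def)
qed

section \<open>Uniform positivity of window products\<close>

lemma transition_nonneg:
  assumes "k \<ge> 1"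
  shows "transition a k n $ i $ j \<ge> 0"
  using assms by (induction n arbitrary: i)
    (auto simp: mat_def matrix_matrix_mult_def intro!: sum_nonneg mult_nonneg_nonneg weight_nonneg)

text \<open>The threshold decays with \<open>n\<close> so that following one more edge of weight at
  least \<open>c0\<close> stays above it.\<close>

definition reached :: "nat \<Rightarrow> 'v \<Rightarrow> nat \<Rightarrow> 'v set" where
  "reached k j n = {i. transition a k n $ i $ j \<ge> c0 ^ n}"

lemma source_reached: "j \<in> reached k j 0"
  by (simp add: reached_def mat_def)

text \<open>All summands of the matrix product are nonnegative, so the single path through
  \<open>i\<close> already gives the bound.\<close>

lemma reached_step:
  assumes "k \<ge> 1" "i \<in> reached k j n" "a (k + n) $ l $ i \<ge> c0"
  shows "l \<in> reached k j (Suc n)"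
proof -
  have "c0 ^ Suc n \<le> a (k + n) $ l $ i * transition a k n $ i $ j"
    using assms c0 by (auto simp: reached_def intro!: mult_mono)
  also have "\<dots> \<le> (\<Sum>i\<in>UNIV. a (k + n) $ l $ i * transition a k n $ i $ j)"
    using assms by (intro member_le_sum) (auto intro!: mult_nonneg_nonneg weight_nonneg transition_nonneg)
  finally show ?thesis by (simp add: reached_def matrix_matrix_mult_def)
qed

lemma reached_mono: 
  assumes "k \<ge> 1" "n \<le> n'"
  shows "reached k j n \<subseteq> reached k j n'"
proof (rule lift_Suc_mono_le[OF _ assms(2)])
  show "reached k j n \<subseteq> reached k j (Suc n)" for n
    using reached_step[OF assms(1)] self_weight_ge assms(1) by auto
qed

text \<open>Any \<open>2 Bt - 1\<close> consecutive iterations contain a complete block of \<open>Bt\<close> iterations.\<close>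

lemma reached_grows:
  assumes k: "k \<ge> 1" and same: "reached k j (n + (2 * Bt - 1)) = reached k j n"
  shows "reached k j n = UNIV"
proof -
  let ?S = "reached k j n"
  have Bt: "Bt > 0" using connected by (simp add: uniformly_strongly_connected_def)
  \<comment> \<open>\<open>t * Bt\<close> is the first block boundary not before
    \<open>k + n\<close>: the quotient is rounded up.\<close>
  define t where "t = (k + n + Bt - 1) div Bt"
  have t: "k + n \<le> t * Bt" "t * Bt + Bt \<le> k + n + (2 * Bt - 1)"
  proof -
    have "t * Bt + (k + n + Bt - 1) mod Bt = k + n + Bt - 1"
      unfolding t_def by (rule div_mult_mod_eq)
    moreover have "(k + n + Bt - 1) mod Bt < Bt" using Bt by simp
    ultimately show "k + n \<le> t * Bt" "t * Bt + Bt \<le> k + n + (2 * Bt - 1)"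
      using Bt by linarith+
  qed
  \<comment> \<open>The reached sets increase and agree at both ends of the window, hence are
    constant on it; no edge active inside the window can leave \<open>?S\<close>.\<close>
  have closed: "l \<in> ?S" if "(l, i) \<in> (\<Union>r\<in>{t * Bt..<t * Bt + Bt}. E r)" "i \<in> ?S" for l i
  proof (cases "l = i")
    case False
    from that obtain r where r: "t * Bt \<le> r" "r < t * Bt + Bt" "(l, i) \<in> E r" by auto
    then have "r = k + (r - k)" and n: "n \<le> r - k" "Suc (r - k) \<le> n + (2 * Bt - 1)"
      using t by linarith+
    then have "i \<in> reached k j (r - k)" using reached_mono[OF k n(1)] that by auto
    then have "l \<in> reached k j (Suc (r - k))"
      using edge_weight_ge[of r l i] r k False \<open>r = k + (r - k)\<close>
      by (intro reached_step[OF k]) auto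
    then show ?thesis using reached_mono[OF k n(2)] same by auto
  qed (use that in simp)
  have "j \<in> ?S" using source_reached reached_mono[OF k, of 0 n] by blast
  \<comment> \<open>A path from \<open>u\<close> to the source \<open>j\<close> is traversed from
    \<open>j\<close> backwards, since an edge \<open>(l, i)\<close> carries information from
    \<open>i\<close> to \<open>l\<close>.\<close>
  have "u \<in> ?S" for u
  proof -
    have "(u, j) \<in> (\<Union>r\<in>{t * Bt..<t * Bt + Bt}. E r)\<^sup>*"
      using connected by (simp add: uniformly_strongly_connected_def strongly_connected_def)
    then show ?thesis
      by (induction rule: converse_rtrancl_induct) (use \<open>j \<in> ?S\<close> closed in auto)
  qed
  then show ?thesis by auto
qed

text \<open>The cardinality exceeds the number of elapsed windows until the set is complete; after
  as many windows as agents the strict inequality is impossible.\<close>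

lemma reached_all:
  assumes k: "k \<ge> 1"
  shows "reached k j mixing_time = UNIV"
proof -
  have "reached k j (r * (2 * Bt - 1)) = UNIV \<or> r < card (reached k j (r * (2 * Bt - 1)))" for r
  proof (induction r)
    case 0
    then show ?case using source_reached[of j k] by (auto simp: card_gt_0_iff)
  next
    case (Suc r)
    let ?n = "r * (2 * Bt - 1)"
    have sub: "reached k j ?n \<subseteq> reached k j (?n + (2 * Bt - 1))"
      by (rule reached_mono[OF k]) simp
    show ?case
    proof (cases "reached k j ?n = UNIV")
      case True
      then show ?thesis using sub by (auto simp: add.commute)
    next
      case False
      then have "reached k j ?n \<subset> reached k j (?n + (2 * Bt - 1))"
        using reached_grows[OF k, of j ?n] sub by auto
      then have "card (reached k j ?n) < card (reached k j (?n + (2 * Bt - 1)))"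
        by (intro psubset_card_mono) auto
      then show ?thesis using Suc False by (simp add: add.commute)
    qed
  qed
  from this[of "CARD('v)"] show ?thesis
    using card_mono[of UNIV "reached k j mixing_time"] by (auto simp: mixing_time_def not_less[symmetric])
qed

lemma transition_ge:
  "k \<ge> 1 \<Longrightarrow> transition a k mixing_time $ i $ j \<ge> c0 ^ mixing_time"
  using reached_all[of k j] by (auto simp: reached_def)

section \<open>Bounds on the push-sum weights\<close>

lemma w_transition:
  assumes "k \<ge> 1"
  shows "w (k + n) $ i = (\<Sum>j\<in>UNIV. transition a k n $ i $ j * w k $ j)"
  using transition_action[of k "\<lambda>k i. w k $ i" a n i] w_Suc assms by simp

lemma w_sum: 
  assumes "k \<ge> 1"
  shows "(\<Sum>i\<in>UNIV. w k $ i) = CARD('v)"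
  using assms
proof (induction k rule: dec_induct)
  case base
  show ?case using w_1 by simp
next
  case (step k)
  have "(\<Sum>i\<in>UNIV. w (Suc k) $ i) = (\<Sum>j\<in>UNIV. (\<Sum>i\<in>UNIV. a k $ i $ j) * w k $ j)"
    unfolding w_Suc[OF step(1)] sum_distrib_right by (rule sum.swap)
  then show ?case using step by (simp add: column_sum)
qed

lemma w_nonneg:
  assumes "k \<ge> 1"
  shows "w k $ i \<ge> 0"
proof -
  have "0 \<le> (\<Sum>j\<in>UNIV. transition a 1 (k - 1) $ i $ j * w 1 $ j)"
    by (intro sum_nonneg mult_nonneg_nonneg transition_nonneg) (simp_all only: w_1 order_refl zero_le_one)
  then show ?thesis
    using w_transition[of 1 "k - 1" i] assms by simp
qed

text \<open>Up to iteration \<open>mixing_time\<close>, self-loops alone preserve enough of the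
  agent's own initial weight 1. Later, a full window has passed on a fraction
  \<open>c0 ^ mixing_time\<close> of the total weight, which is the number of agents.\<close>

lemma w_ge:
  assumes k: "k \<ge> 1"
  shows "w k $ i \<ge> c0 ^ mixing_time"
proof (cases "k \<le> mixing_time")
  case True
  have "i \<in> reached 1 i (k - 1)"
    using source_reached reached_mono[of 1 0 "k - 1"] by auto
  moreover have "c0 ^ mixing_time \<le> c0 ^ (k - 1)"
    using True c0 c0_lt_1 by (intro power_decreasing) auto
  ultimately have "c0 ^ mixing_time \<le> transition a 1 (k - 1) $ i $ i"
    by (auto simp: reached_def)
  also have "\<dots> \<le> (\<Sum>j\<in>UNIV. transition a 1 (k - 1) $ i $ j)"
    by (intro member_le_sum transition_nonneg) auto
  also have "\<dots> = w k $ i"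
    using w_transition[of 1 "k - 1" i] k w_1 by simp
  finally show ?thesis .
next
  case False
  define n where "n = k - mixing_time"
  have n: "n \<ge> 1" "k = n + mixing_time" using False by (auto simp: n_def)
  have "c0 ^ mixing_time \<le> c0 ^ mixing_time * CARD('v)"
    using c0 by (simp add: Suc_leI)
  also have "\<dots> = (\<Sum>j\<in>UNIV. c0 ^ mixing_time * w n $ j)"
    by (simp add: w_sum[OF n(1)] sum_distrib_left[symmetric])
  also have "\<dots> \<le> w k $ i"
    unfolding n(2) w_transition[OF n(1)]
    by (intro sum_mono mult_right_mono transition_ge w_nonneg n)
  finally show ?thesis .
qed

lemma w_pos: "k \<ge> 1 \<Longrightarrow> w k $ i > 0"
  by (rule less_le_trans[OF zero_less_power[OF c0(1)] w_ge])

lemma w_le: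
  assumes "k \<ge> 1"
  shows "w k $ i \<le> CARD('v)"
  unfolding w_sum[OF assms, symmetric] by (intro member_le_sum w_nonneg assms) auto

section \<open>Contraction over a window, with perturbations\<close>

lemma spread_step_le:
  fixes u :: "'v \<Rightarrow> 'a::real_normed_vector"
  assumes "k \<ge> 1"
  shows "spread (\<lambda>i. (\<Sum>j\<in>UNIV. a k $ i $ j *\<^sub>R u j) /\<^sub>R w (Suc k) $ i)
    \<le> spread (\<lambda>i. u i /\<^sub>R w k $ i)"
proof -
  have "spread (\<lambda>i. (\<Sum>j\<in>UNIV. a k $ i $ j *\<^sub>R u j) /\<^sub>R w (Suc k) $ i)
    \<le> (1 - 0) * spread (\<lambda>i. u i /\<^sub>R w k $ i)"
    by (rule spread_mixing_le)
      (use assms in \<open>auto intro!: w_pos w_Suc mult_nonneg_nonneg weight_nonneg w_nonneg\<close>)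
  then show ?thesis by simp
qed

text \<open>The trajectory splits into the unperturbed evolution \<open>v\<close> of the starting
  values, which contracts over the window, and a remainder \<open>d\<close> that starts at 0. Single
  steps do not expand diameters, so that of \<open>d\<close> is at most the sum of the
  perturbations.\<close>

lemma spread_window_le:
  fixes u :: "nat \<Rightarrow> 'v \<Rightarrow> 'a::real_normed_vector"
  assumes k: "k \<ge> 1"
    and u: "\<And>t i. t \<ge> k \<Longrightarrow> u (Suc t) i = (\<Sum>j\<in>UNIV. a t $ i $ j *\<^sub>R u t j) + e t i"
  shows "spread (\<lambda>i. u (k + mixing_time) i /\<^sub>R w (k + mixing_time) $ i)
    \<le> (1 - c0 ^ (2 * mixing_time + 1)) * spread (\<lambda>i. u k i /\<^sub>R w k $ i)
      + (\<Sum>l<mixing_time. spread (\<lambda>i. e (k + l) i /\<^sub>R w (Suc (k + l)) $ i))"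
proof -
  define T where "T = mixing_time"
  define \<rho> where "\<rho> = c0 ^ (2 * mixing_time + 1)"
  define v where "v = (\<lambda>n i. \<Sum>j\<in>UNIV. transition a k n $ i $ j *\<^sub>R u k j)"
  define d where "d = (\<lambda>n i. u (k + n) i - v n i)"
  have d_Suc: "d (Suc n) i = (\<Sum>j\<in>UNIV. a (k + n) $ i $ j *\<^sub>R d n j) + e (k + n) i" for n i
    by (simp add: d_def v_def u transition_Suc_action scaleR_diff_right sum_subtractf del: transition.simps)
  have drift: "spread (\<lambda>i. d n i /\<^sub>R w (k + n) $ i)
      \<le> (\<Sum>l<n. spread (\<lambda>i. e (k + l) i /\<^sub>R w (Suc (k + l)) $ i))" for n
  proof (induction n)
    case 0
    have "d 0 = (\<lambda>i. 0)"
      by (simp add: d_def v_def transition_0_action fun_eq_iff del: transition.simps)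
    then show ?case by (auto intro!: spread_leI)
  next
    case (Suc n)
    have "spread (\<lambda>i. d (Suc n) i /\<^sub>R w (k + Suc n) $ i)
      \<le> spread (\<lambda>i. (\<Sum>j\<in>UNIV. a (k + n) $ i $ j *\<^sub>R d n j) /\<^sub>R w (Suc (k + n)) $ i)
        + spread (\<lambda>i. e (k + n) i /\<^sub>R w (Suc (k + n)) $ i)"
      unfolding d_Suc add_Suc_right scaleR_add_right by (rule spread_add_le)
    then show ?case using Suc spread_step_le[of "k + n" "d n"] k by simp
  qed
  \<comment> \<open>Two factors \<open>c0 ^ T\<close> come from the transition entry and from
    \<open>w k $ j\<close>; the extra \<open>c0\<close> compensates \<open>w (k + T) $ i\<close>,
    which is at most the number of agents and so below \<open>1 / c0\<close>.\<close>
  have mixing: "\<rho> * w (k + T) $ i \<le> transition a k T $ i $ j * w k $ j" for i j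
  proof -
    have "c0 * w (k + T) $ i \<le> 1"
      using c0 w_le[of "k + T" i] k mult_mono[of c0 "1 / CARD('v)" "w (k + T) $ i" "CARD('v)"]
        w_nonneg[of "k + T" i] by simp
    then have "c0 ^ T * c0 ^ T * (c0 * w (k + T) $ i) \<le> c0 ^ T * c0 ^ T * 1"
      using c0 by (intro mult_left_mono) auto
    also have "\<dots> \<le> transition a k T $ i $ j * w k $ j"
      unfolding T_def using c0 transition_ge[OF k, of i j] w_ge[OF k, of j]
      by (auto intro!: mult_mono transition_nonneg[OF k])
    finally show ?thesis
      unfolding \<rho>_def T_def[symmetric] mult_2 power_add power_one_right by (simp only: mult_ac mult_1_right)
  qed
  have "spread (\<lambda>i. v T i /\<^sub>R w (k + T) $ i) \<le> (1 - \<rho>) * spread (\<lambda>i. u k i /\<^sub>R w k $ i)"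
    unfolding v_def using k c0 mixing
    by (intro spread_mixing_le) (auto simp: w_pos w_transition[symmetric] \<rho>_def)
  moreover have "spread (\<lambda>i. u (k + T) i /\<^sub>R w (k + T) $ i)
      \<le> spread (\<lambda>i. v T i /\<^sub>R w (k + T) $ i) + spread (\<lambda>i. d T i /\<^sub>R w (k + T) $ i)"
    using spread_add_le[of "\<lambda>i. v T i /\<^sub>R w (k + T) $ i" "\<lambda>i. d T i /\<^sub>R w (k + T) $ i"]
    by (simp add: d_def scaleR_add_right[symmetric])
  ultimately show ?thesis using drift[of T] unfolding \<rho>_def T_def by linarith
qed

end

section \<open>The maximum norm of the inverse weight matrices\<close>

lemma matrix_inv_diag_mat:
  fixes v :: "real^'v::finite"
  assumes "\<And>i. v $ i \<noteq> 0"
  shows "matrix_inv (diag_mat v) = diag_mat (\<chi> i. inverse (v $ i))"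
proof -
  let ?D = "diag_mat v" and ?D' = "diag_mat (\<chi> i. inverse (v $ i))"
  have D: "?D ** ?D' = mat 1" "?D' ** ?D = mat 1"
    using assms by (auto simp: diag_mat_def matrix_matrix_mult_def mat_def vec_eq_iff mult_delta_left)
  have "?D ** matrix_inv ?D = mat 1"
    unfolding matrix_inv_def
    using someI[of "\<lambda>A. ?D ** A = mat 1 \<and> A ** ?D = mat 1" ?D'] D by blast
  then have "?D' ** (?D ** matrix_inv ?D) = ?D'" by simp
  then show ?thesis using D by (simp add: matrix_mul_assoc)
qed

lemma max_norm_eq_Max_range: "max_norm M = Max (range (\<lambda>(i, j). \<bar>M $ i $ j\<bar>))"
  unfolding max_norm_def by (rule arg_cong[where f = Max]) auto

lemma max_norm_entry: "\<bar>M $ i $ j\<bar> \<le> max_norm M"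
  unfolding max_norm_eq_Max_range by (rule Max_ge) (auto intro: image_eqI[of _ _ "(i, j)"])

lemma max_norm_leI: "(\<And>i j. \<bar>M $ i $ j\<bar> \<le> b) \<Longrightarrow> max_norm M \<le> b"
  unfolding max_norm_eq_Max_range by auto

text \<open>The uniform lower bound \<open>w_ge\<close> makes the family of norms bounded above, so
  that the real supremum really dominates each member.\<close>

lemma (in push_sum) inverse_w_le_SUP:
  assumes k: "k \<ge> 1"
  shows "inverse (w k $ i) \<le> (SUP k\<in>{1..}. max_norm (matrix_inv (diag_mat (w k))))"
proof -
  have inv: "matrix_inv (diag_mat (w k)) = diag_mat (\<chi> i. inverse (w k $ i))" if "k \<ge> 1" for k
    by (rule matrix_inv_diag_mat) (use w_pos[OF that] in \<open>simp add: less_imp_neq[symmetric]\<close>)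
  have "max_norm (matrix_inv (diag_mat (w k))) \<le> inverse (c0 ^ mixing_time)" if "k \<ge> 1" for k
    unfolding inv[OF that]
  proof (rule max_norm_leI)
    show "\<bar>diag_mat (\<chi> i. inverse (w k $ i)) $ i $ j\<bar> \<le> inverse (c0 ^ mixing_time)" for i j
      using le_imp_inverse_le[OF w_ge[OF that, of i]] w_pos[OF that, of i] c0
      by (auto simp: diag_mat_def)
  qed
  then have "bdd_above ((\<lambda>k. max_norm (matrix_inv (diag_mat (w k)))) ` {1..})"
    by (intro bdd_aboveI2[where M = "inverse (c0 ^ mixing_time)"]) simp
  then have "max_norm (matrix_inv (diag_mat (w k))) \<le> (SUP k\<in>{1..}. max_norm (matrix_inv (diag_mat (w k))))"
    using k by (intro cSUP_upper) auto
  moreover have "inverse (w k $ i) \<le> max_norm (matrix_inv (diag_mat (w k)))"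
    using max_norm_entry[of "diag_mat (\<chi> i. inverse (w k $ i))" i i]
    using w_pos[OF k, of i] by (subst inv[OF k]) (simp add: diag_mat_def)
  ultimately show ?thesis by linarith
qed

subsection \<open>Gradient steps without a descent lemma\<close>

text \<open>Adding the convexity inequalities for both orders of the two points gives strong
  monotonicity of \<open>G\<close>, which Cauchy-Schwarz and the Lipschitz bound cap by
  \<open>L\<close>.\<close>

lemma strong_convexity_modulus_le_smoothness:
  fixes F :: "'a::real_inner \<Rightarrow> real" and x y :: 'a
  assumes convex: "\<And>x y. F y \<ge> F x + G x \<bullet> (y - x) + \<mu> / 2 * (norm (y - x))\<^sup>2"
    and lipschitz: "\<And>x y. norm (G x - G y) \<le> L * norm (x - y)"
    and "x \<noteq> y"
  shows "\<mu> \<le> L"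
proof -
  have "\<mu> * (norm (y - x))\<^sup>2 \<le> (G y - G x) \<bullet> (y - x)"
    using convex[where x = x and y = y] convex[where x = y and y = x]
    by (simp add: norm_minus_commute inner_diff_left inner_diff_right)
  also have "\<dots> \<le> norm (G y - G x) * norm (y - x)"
    by (rule norm_cauchy_schwarz)
  also have "\<dots> \<le> L * (norm (y - x))\<^sup>2"
    using mult_right_mono[OF lipschitz[of y x], of "norm (y - x)"]
    by (simp add: power2_eq_square mult.assoc)
  finally show ?thesis using \<open>x \<noteq> y\<close> by simp
qed

text \<open>
  Convexity at the shifted point replaces the descent lemma. This loses a factor 2 but requires no
  integration along the segment.
\<close>

lemma norm_gradient_le_gap:
  fixes F :: "'a::real_inner \<Rightarrow> real"
  assumes convex: "\<And>x y. F y \<ge> F x + G x \<bullet> (y - x)"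
    and lipschitz: "\<And>x y. norm (G x - G y) \<le> L * norm (x - y)"
    and min: "\<And>x. F xmin \<le> F x" and "L > 0"
  shows "(norm (G x))\<^sup>2 \<le> 4 * L * (F x - F xmin)"
proof -
  \<comment> \<open>With \<open>L * c = 1 / 2\<close>, replacing \<open>G x\<close> by
    \<open>G y\<close> in the inner product with \<open>x - y\<close> loses at most half of its
    value.\<close>
  define c where "c = 1 / (2 * L)"
  define y where "y = x - c *\<^sub>R G x"
  have "c > 0" "L * c = 1 / 2" using \<open>L > 0\<close> by (simp_all add: c_def)
  have "(G x - G y) \<bullet> (x - y) \<le> norm (G x - G y) * norm (x - y)"
    by (rule norm_cauchy_schwarz)
  also have "\<dots> \<le> L * norm (x - y) * norm (x - y)"
    by (intro mult_right_mono lipschitz) simp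
  also have "\<dots> = (L * c) * c * (norm (G x))\<^sup>2"
    using \<open>c > 0\<close> by (simp add: y_def power2_eq_square)
  finally have "(G x - G y) \<bullet> (x - y) \<le> c * (norm (G x))\<^sup>2 / 2"
    using \<open>L * c = 1 / 2\<close> by simp
  moreover have "G x \<bullet> (x - y) = c * (norm (G x))\<^sup>2"
    by (simp add: y_def power2_norm_eq_inner)
  ultimately have "c * (norm (G x))\<^sup>2 / 2 \<le> G y \<bullet> (x - y)"
    by (simp add: inner_diff_left)
  also have "\<dots> \<le> F x - F xmin"
    using convex[where x = y and y = x] min[of y] by simp
  finally show ?thesis
    using \<open>L > 0\<close> by (simp add: c_def field_simps)
qed

text \<open>In the expanded square, the cross term supplies \<open>-2 * \<eta> * gap\<close>, which
  pays for the squared gradient because \<open>\<eta> * L \<le> 1 / 2\<close>. What remains is the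
  factor \<open>1 - \<eta> * \<mu>\<close>, bounded by a perfect square before taking roots.\<close>

lemma gradient_step_contracts:
  fixes F :: "'a::real_inner \<Rightarrow> real"
  assumes convex: "\<And>x y. F y \<ge> F x + G x \<bullet> (y - x) + \<mu> / 2 * (norm (y - x))\<^sup>2"
    and lipschitz: "\<And>x y. norm (G x - G y) \<le> L * norm (x - y)"
    and min: "\<And>x. F xmin \<le> F x"
    and \<mu>: "0 \<le> \<mu>" "\<mu> \<le> L" and L: "L > 0" and \<eta>: "\<eta> > 0" "\<eta> * L \<le> 1 / 2"
  shows "norm (x - \<eta> *\<^sub>R G x - xmin) \<le> (1 - \<eta> * \<mu> / 2) * norm (x - xmin)"
proof -
  define e where "e = x - xmin"
  define gap where "gap = F x - F xmin"
  have convex0: "F y \<ge> F x + G x \<bullet> (y - x)" for x y :: 'a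
    by (rule order_trans[OF _ convex[where x = x]]) (simp add: \<mu>)
  have G: "(norm (G x))\<^sup>2 \<le> 4 * L * gap"
    unfolding gap_def by (rule norm_gradient_le_gap[OF convex0 lipschitz min L])
  have "gap \<ge> 0" using min by (simp add: gap_def)
  have "gap + \<mu> / 2 * (norm e)\<^sup>2 \<le> G x \<bullet> e"
    using convex[where x = x and y = xmin]
    by (simp add: gap_def e_def inner_diff_right norm_minus_commute)
  then have cross: "2 * \<eta> * (gap + \<mu> / 2 * (norm e)\<^sup>2) \<le> 2 * \<eta> * (G x \<bullet> e)"
    using \<eta> by (intro mult_left_mono) auto
  have "\<eta>\<^sup>2 * (norm (G x))\<^sup>2 \<le> \<eta>\<^sup>2 * (4 * L * gap)"
    using G by (intro mult_left_mono) auto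
  also have "\<dots> = (\<eta> * L) * (4 * \<eta> * gap)"
    by (simp add: power2_eq_square)
  also have "\<dots> \<le> 1 / 2 * (4 * \<eta> * gap)"
    using \<eta> \<open>gap \<ge> 0\<close> by (intro mult_right_mono) auto
  finally have square: "\<eta>\<^sup>2 * (norm (G x))\<^sup>2 \<le> 2 * \<eta> * gap" by simp
  have \<eta>\<mu>: "\<eta> * \<mu> \<le> 1 / 2"
    using mult_left_mono[OF \<mu>(2), of \<eta>] \<eta> by linarith
  have "(norm (e - \<eta> *\<^sub>R G x))\<^sup>2 = (norm e)\<^sup>2 - 2 * \<eta> * (G x \<bullet> e) + \<eta>\<^sup>2 * (norm (G x))\<^sup>2"
    unfolding power2_norm_eq_inner
    by (simp add: inner_diff_left inner_diff_right inner_commute power2_eq_square algebra_simps)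
  also have "\<dots> \<le> (1 - \<eta> * \<mu>) * (norm e)\<^sup>2"
    using cross square by (simp add: algebra_simps)
  also have "\<dots> \<le> (1 - \<eta> * \<mu> / 2)\<^sup>2 * (norm e)\<^sup>2"
    by (intro mult_right_mono) (simp_all add: power2_diff)
  finally have "(norm (e - \<eta> *\<^sub>R G x))\<^sup>2 \<le> ((1 - \<eta> * \<mu> / 2) * norm e)\<^sup>2"
    by (simp add: power_mult_distrib)
  then have "norm (e - \<eta> *\<^sub>R G x) \<le> (1 - \<eta> * \<mu> / 2) * norm e"
    by (rule power2_le_imp_le) (use \<eta>\<mu> in simp)
  moreover have eq: "x - \<eta> *\<^sub>R G x - xmin = e - \<eta> *\<^sub>R G x"
    by (simp add: e_def)
  ultimately show ?thesis unfolding eq by (simp only: e_def)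
qed

subsection \<open>Gradient tracking\<close>

text \<open>With \<open>\<theta>\<close> the \<open>T\<close>-th root of \<open>\<gamma>\<close>, a
  window contributes exactly \<open>\<theta> ^ T\<close>. The constant \<open>C\<close> dominates
  the first \<open>T\<close> values, and strong induction feeds the bounds on the preceding window
  into \<open>step\<close>.\<close>

lemma windowed_contraction_imp_geometric:
  fixes V :: "nat \<Rightarrow> real"
  assumes "T > 0" "0 < \<gamma>" "\<gamma> < 1"
    and step: "\<And>k C. (\<And>l. l < T \<Longrightarrow> V (k + l) \<le> C) \<Longrightarrow> V (k + T) \<le> \<gamma> * C"
  shows "\<exists>\<theta> C. 0 < \<theta> \<and> \<theta> < 1 \<and> (\<forall>k. V k \<le> C * \<theta> ^ k)"
proof -
  define \<theta> where "\<theta> = root T \<gamma>"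
  have \<theta>: "0 < \<theta>" "\<theta> < 1" "\<theta> ^ T = \<gamma>"
    using assms by (auto simp: \<theta>_def)
  define C where "C = (\<Sum>l<T. \<bar>V l\<bar> / \<theta> ^ l)"
  have "C \<ge> 0" using \<theta> by (auto simp: C_def intro!: sum_nonneg)
  have "V k \<le> C * \<theta> ^ k" for k
  proof (induction k rule: less_induct)
    case (less k)
    show ?case
    proof (cases "k < T")
      case True
      then have "\<bar>V k\<bar> / \<theta> ^ k \<le> C"
        unfolding C_def using \<theta> by (intro member_le_sum) auto
      then show ?thesis using \<theta> by (simp add: field_simps)
    next
      case False
      then obtain j where k: "k = j + T" by (metis add.commute le_Suc_ex not_less)
      have "V (j + l) \<le> C * \<theta> ^ j" if "l < T" for l
      proof -
        have "V (j + l) \<le> C * \<theta> ^ (j + l)" using that k by (intro less.IH) auto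
        also have "\<dots> \<le> C * \<theta> ^ j"
          using \<theta> \<open>C \<ge> 0\<close> by (intro mult_left_mono power_decreasing) auto
        finally show ?thesis .
      qed
      from step[OF this] show ?thesis using \<theta> by (simp add: k power_add mult_ac)
    qed
  qed
  then show ?thesis using \<theta> by blast
qed

text \<open>The maps \<open>g i\<close> enter through a common Lipschitz constant only, which
  separates the consensus and tracking estimates from convexity; \<open>winv\<close> is any uniform
  bound on the inverse weights.\<close>

locale gradient_tracking = push_sum c0 E Bt a w
  for c0 :: real and E :: "nat \<Rightarrow> ('v::finite \<times> 'v) set" and Bt :: nat
    and a :: "nat \<Rightarrow> real^'v^'v" and w :: "nat \<Rightarrow> real^'v" +
  fixes g :: "'v \<Rightarrow> 'a::real_normed_vector \<Rightarrow> 'a" and x y s :: "nat \<Rightarrow> 'v \<Rightarrow> 'a"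
    and \<eta> K winv :: real
  assumes x_eq: "k \<ge> 1 \<Longrightarrow> x k i = y k i /\<^sub>R w k $ i"
    and y_Suc: "y (Suc k) i = (\<Sum>j\<in>UNIV. a k $ i $ j *\<^sub>R (y k j - \<eta> *\<^sub>R s k j))"
    and s_0: "s 0 i = g i (x 0 i)"
    and s_Suc: "s (Suc k) i = (\<Sum>j\<in>UNIV. a k $ i $ j *\<^sub>R s k j) + g i (x (Suc k) i) - g i (x k i)"
    and lipschitz: "norm (g i z - g i z') \<le> K * norm (z - z')"
    and K_nonneg: "K \<ge> 0"
    and winv: "k \<ge> 1 \<Longrightarrow> inverse (w k $ i) \<le> winv"
    and \<eta>_pos: "\<eta> > 0"
begin

lemma winv_pos: "winv > 0"
  using winv[of 1 undefined] w_1 by simp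

definition h :: "nat \<Rightarrow> 'v \<Rightarrow> 'a" where
  "h k i = s k i /\<^sub>R w k $ i"

text \<open>The plain mean of \<open>y\<close> is preserved by column-stochastic mixing, and for
  \<open>k \<ge> 1\<close> it is a convex combination of the \<open>x k i\<close> with weights
  \<open>w k $ i / CARD('v)\<close>.\<close>

definition y_mean :: "nat \<Rightarrow> 'a" where
  "y_mean k = (\<Sum>i\<in>UNIV. y k i) /\<^sub>R CARD('v)"

definition s_mean :: "nat \<Rightarrow> 'a" where
  "s_mean k = (\<Sum>i\<in>UNIV. s k i) /\<^sub>R CARD('v)"

lemma sum_mixing:
  fixes u :: "'v \<Rightarrow> 'b::real_vector"
  shows "(\<Sum>i\<in>UNIV. \<Sum>j\<in>UNIV. a k $ i $ j *\<^sub>R u j) = (\<Sum>j\<in>UNIV. u j)"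
  by (subst sum.swap) (simp add: scaleR_left.sum[symmetric] column_sum)

text \<open>The tracking invariant: mixing preserves the sum of the \<open>s k i\<close>, the
  increments of \<open>g\<close> telescope, and the initialization matches.\<close>

lemma s_mean_eq: "s_mean k = (\<Sum>i\<in>UNIV. g i (x k i)) /\<^sub>R CARD('v)"
proof -
  have "(\<Sum>i\<in>UNIV. s k i) = (\<Sum>i\<in>UNIV. g i (x k i))"
    by (induction k) (simp_all add: s_0 s_Suc sum.distrib sum_subtractf sum_mixing)
  then show ?thesis by (simp add: s_mean_def)
qed

lemma y_mean_Suc: "y_mean (Suc k) = y_mean k - \<eta> *\<^sub>R s_mean k"
  unfolding y_mean_def s_mean_def y_Suc sum_mixing sum_subtractf scaleR_right.sum[symmetric]
  by (simp add: scaleR_diff_right mult.commute)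

lemma mean_as_weighted_mean:
  fixes u :: "'v \<Rightarrow> 'a"
  assumes "k \<ge> 1"
  shows "(\<Sum>i\<in>UNIV. u i) /\<^sub>R CARD('v) = (\<Sum>i\<in>UNIV. (w k $ i / CARD('v)) *\<^sub>R (u i /\<^sub>R w k $ i))"
  unfolding scaleR_right.sum using less_imp_neq[OF w_pos[OF assms]]
  by (intro sum.cong refl) (simp add: field_simps)

lemma mean_weights:
  assumes "k \<ge> 1"
  shows "w k $ i / CARD('v) \<ge> 0" "(\<Sum>i\<in>UNIV. w k $ i / CARD('v)) = 1"
  using w_nonneg[OF assms] w_sum[OF assms] by (simp_all add: sum_divide_distrib[symmetric])

lemma row_weights:
  assumes "k \<ge> 1"
  shows "a k $ i $ j * w k $ j / w (Suc k) $ i \<ge> 0"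
    and "(\<Sum>j\<in>UNIV. a k $ i $ j * w k $ j / w (Suc k) $ i) = 1"
proof -
  show "a k $ i $ j * w k $ j / w (Suc k) $ i \<ge> 0"
    using assms by (simp add: weight_nonneg w_nonneg)
  show "(\<Sum>j\<in>UNIV. a k $ i $ j * w k $ j / w (Suc k) $ i) = 1"
    using w_pos[of "Suc k" i] w_Suc[OF assms, of i] by (simp add: sum_divide_distrib[symmetric])
qed

lemma x_near_mean:
  assumes "k \<ge> 1"
  shows "norm (x k i - y_mean k) \<le> spread (x k)"
  unfolding y_mean_def mean_as_weighted_mean[OF assms]
  using norm_diff_mean_le_spread[of "\<lambda>i. w k $ i / CARD('v)" "x k" i] mean_weights[OF assms]
  by (simp add: x_eq[OF assms] norm_minus_commute)

lemma norm_x_diff_le: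
  assumes "k \<ge> 1"
  shows "norm (x k i - z) \<le> spread (x k) + norm (y_mean k - z)"
  using x_near_mean[OF assms, of i] norm_triangle_ineq[of "x k i - y_mean k" "y_mean k - z"] by simp

lemma x_Suc:
  assumes "k \<ge> 1"
  shows "x (Suc k) i = (\<Sum>j\<in>UNIV. (a k $ i $ j * w k $ j / w (Suc k) $ i) *\<^sub>R x k j)
    - \<eta> *\<^sub>R (\<Sum>j\<in>UNIV. (a k $ i $ j * w k $ j / w (Suc k) $ i) *\<^sub>R h k j)"
proof -
  have "x (Suc k) i = (\<Sum>j\<in>UNIV. (a k $ i $ j * w k $ j / w (Suc k) $ i) *\<^sub>R
      ((y k j - \<eta> *\<^sub>R s k j) /\<^sub>R w k $ j))"
    unfolding x_eq[of "Suc k", simplified] y_Suc using assms by (intro mixing_as_mean w_pos)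
  also have "\<dots> = (\<Sum>j\<in>UNIV. (a k $ i $ j * w k $ j / w (Suc k) $ i) *\<^sub>R (x k j - \<eta> *\<^sub>R h k j))"
    using assms by (simp add: x_eq h_def scaleR_diff_right mult.commute)
  finally show ?thesis
    by (simp add: scaleR_diff_right sum_subtractf scaleR_right.sum mult_ac)
qed

text \<open>The averaged \<open>x\<close> stays within its diameter of \<open>x k i\<close>. The
  averaged \<open>h\<close> and \<open>s_mean k\<close> are both convex combinations of the
  \<open>h k j\<close>, hence differ by at most the diameter of \<open>h k\<close>.\<close>

lemma norm_x_Suc_diff_le:
  assumes "k \<ge> 1"
  shows "norm (x (Suc k) i - x k i) \<le> spread (x k) + \<eta> * (spread (h k) + norm (s_mean k))"
proof -
  let ?P = "\<lambda>j. a k $ i $ j * w k $ j / w (Suc k) $ i"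
  have "norm ((\<Sum>j\<in>UNIV. ?P j *\<^sub>R h k j) - s_mean k) \<le> 1 * spread (h k)"
    unfolding s_mean_def mean_as_weighted_mean[OF assms] h_def[symmetric]
    using mean_weights[OF assms] row_weights[OF assms]
    by (intro norm_weighted_diff_le_spread) auto
  then have "norm (\<Sum>j\<in>UNIV. ?P j *\<^sub>R h k j) \<le> spread (h k) + norm (s_mean k)"
    using norm_triangle_ineq2[of "\<Sum>j\<in>UNIV. ?P j *\<^sub>R h k j" "s_mean k"] by linarith
  then have "norm (\<eta> *\<^sub>R (\<Sum>j\<in>UNIV. ?P j *\<^sub>R h k j)) \<le> \<eta> * (spread (h k) + norm (s_mean k))"
    using \<eta>_pos by simp
  moreover have "norm ((\<Sum>j\<in>UNIV. ?P j *\<^sub>R x k j) - x k i) \<le> spread (x k)"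
    using row_weights[OF assms] by (intro norm_diff_mean_le_spread) auto
  ultimately show ?thesis
    using norm_triangle_ineq4[of "(\<Sum>j\<in>UNIV. ?P j *\<^sub>R x k j) - x k i" "\<eta> *\<^sub>R (\<Sum>j\<in>UNIV. ?P j *\<^sub>R h k j)"]
    unfolding x_Suc[OF assms] by (simp add: algebra_simps)
qed

text \<open>The perturbation \<open>- \<eta> *\<^sub>R s\<close> of \<open>y\<close> is mixed by the
  same matrix, so in the new coordinates its diameter is at most \<open>\<eta>\<close> times that of
  \<open>h\<close>.\<close>

lemma spread_x_window:
  assumes "k \<ge> 1"
  shows "spread (x (k + mixing_time)) \<le> (1 - c0 ^ (2 * mixing_time + 1)) * spread (x k)
    + (\<Sum>l<mixing_time. \<eta> * spread (h (k + l)))"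
proof -
  let ?e = "\<lambda>t i. \<Sum>j\<in>UNIV. a t $ i $ j *\<^sub>R (- \<eta> *\<^sub>R s t j)"
  have e: "spread (\<lambda>i. ?e t i /\<^sub>R w (Suc t) $ i) \<le> \<eta> * spread (h t)" if "t \<ge> 1" for t
  proof -
    have "spread (\<lambda>i. ?e t i /\<^sub>R w (Suc t) $ i) \<le> spread (\<lambda>i. (- \<eta> *\<^sub>R s t i) /\<^sub>R w t $ i)"
      by (rule spread_step_le[OF that])
    also have "(\<lambda>i. (- \<eta> *\<^sub>R s t i) /\<^sub>R w t $ i) = (\<lambda>i. (- \<eta>) *\<^sub>R h t i)"
      by (simp add: h_def fun_eq_iff mult.commute)
    also have "spread \<dots> \<le> \<bar>- \<eta>\<bar> * spread (h t)"
      by (rule spread_scaleR_le)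
    finally show ?thesis using \<eta>_pos by simp
  qed
  have "y (Suc t) i = (\<Sum>j\<in>UNIV. a t $ i $ j *\<^sub>R y t j) + ?e t i" for t i
    by (simp add: y_Suc sum.distrib[symmetric] scaleR_diff_right)
  then have "spread (\<lambda>i. y (k + mixing_time) i /\<^sub>R w (k + mixing_time) $ i)
      \<le> (1 - c0 ^ (2 * mixing_time + 1)) * spread (\<lambda>i. y k i /\<^sub>R w k $ i)
        + (\<Sum>l<mixing_time. spread (\<lambda>i. ?e (k + l) i /\<^sub>R w (Suc (k + l)) $ i))"
    by (rule spread_window_le[OF assms])
  moreover have "(\<Sum>l<mixing_time. spread (\<lambda>i. ?e (k + l) i /\<^sub>R w (Suc (k + l)) $ i))
      \<le> (\<Sum>l<mixing_time. \<eta> * spread (h (k + l)))"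
    using assms by (intro sum_mono e) auto
  moreover have "(\<lambda>i. y t i /\<^sub>R w t $ i) = x t" if "t \<ge> 1" for t
    using that by (simp add: x_eq fun_eq_iff)
  ultimately show ?thesis using assms by (simp only: trans_le_add1)
qed

text \<open>The perturbation of \<open>s\<close> is an increment of \<open>g\<close>, bounded by
  \<open>K\<close> times the movement of \<open>x\<close>. Division by \<open>w\<close> costs
  \<open>winv\<close>, and passing from norms to a diameter costs the factor 2.\<close>

lemma spread_h_window:
  assumes "k \<ge> 1"
  shows "spread (h (k + mixing_time)) \<le> (1 - c0 ^ (2 * mixing_time + 1)) * spread (h k)
    + (\<Sum>l<mixing_time. 2 * winv * K *
        (spread (x (k + l)) + \<eta> * (spread (h (k + l)) + norm (s_mean (k + l)))))"
proof -
  let ?e = "\<lambda>t i. g i (x (Suc t) i) - g i (x t i)"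
  have e: "spread (\<lambda>i. ?e t i /\<^sub>R w (Suc t) $ i)
      \<le> 2 * winv * K * (spread (x t) + \<eta> * (spread (h t) + norm (s_mean t)))" (is "_ \<le> 2 * winv * K * ?\<delta>")
    if t: "t \<ge> 1" for t
  proof (rule spread_leI)
    have single: "norm (?e t i /\<^sub>R w (Suc t) $ i) \<le> winv * K * ?\<delta>" for i
    proof -
      have "norm (?e t i) \<le> K * ?\<delta>"
        by (rule order_trans[OF lipschitz mult_left_mono[OF norm_x_Suc_diff_le[OF t] K_nonneg]])
      then have "inverse (w (Suc t) $ i) * norm (?e t i) \<le> winv * (K * ?\<delta>)"
        using winv[of "Suc t" i] winv_pos by (intro mult_mono) auto
      then show ?thesis using w_pos[of "Suc t" i] by (simp add: abs_of_pos)
    qed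
    show "norm (?e t i /\<^sub>R w (Suc t) $ i - ?e t j /\<^sub>R w (Suc t) $ j) \<le> 2 * winv * K * ?\<delta>" for i j
      using single[of i] single[of j]
        norm_triangle_ineq4[of "?e t i /\<^sub>R w (Suc t) $ i" "?e t j /\<^sub>R w (Suc t) $ j"] by linarith
  qed
  have "s (Suc t) i = (\<Sum>j\<in>UNIV. a t $ i $ j *\<^sub>R s t j) + ?e t i" for t i
    by (simp add: s_Suc)
  then have "spread (\<lambda>i. s (k + mixing_time) i /\<^sub>R w (k + mixing_time) $ i)
      \<le> (1 - c0 ^ (2 * mixing_time + 1)) * spread (\<lambda>i. s k i /\<^sub>R w k $ i)
        + (\<Sum>l<mixing_time. spread (\<lambda>i. ?e (k + l) i /\<^sub>R w (Suc (k + l)) $ i))"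
    by (rule spread_window_le[OF assms])
  moreover have "(\<Sum>l<mixing_time. spread (\<lambda>i. ?e (k + l) i /\<^sub>R w (Suc (k + l)) $ i))
      \<le> (\<Sum>l<mixing_time. 2 * winv * K *
        (spread (x (k + l)) + \<eta> * (spread (h (k + l)) + norm (s_mean (k + l)))))"
    using assms by (intro sum_mono e) auto
  ultimately show ?thesis by (simp add: h_def[abs_def])
qed

lemma norm_mean_le:
  fixes u :: "'v \<Rightarrow> 'a"
  assumes "\<And>i. norm (u i) \<le> b"
  shows "norm ((\<Sum>i\<in>UNIV. u i) /\<^sub>R CARD('v)) \<le> b"
  using sum_norm_bound[of UNIV u b] assms by (simp add: field_simps)

text \<open>Subtracting the vanishing sum of the \<open>g i z\<close> turns the mean into one of
  differences, to which the Lipschitz bound applies.\<close>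

lemma norm_s_mean_le:
  assumes "k \<ge> 1" and stationary: "(\<Sum>i\<in>UNIV. g i z) = 0"
  shows "norm (s_mean k) \<le> K * (spread (x k) + norm (y_mean k - z))"
proof -
  have "s_mean k = (\<Sum>i\<in>UNIV. g i (x k i) - g i z) /\<^sub>R CARD('v)"
    by (simp add: s_mean_eq sum_subtractf stationary)
  also have "norm \<dots> \<le> K * (spread (x k) + norm (y_mean k - z))"
    using norm_x_diff_le[OF assms(1), of _ z] K_nonneg
    by (intro norm_mean_le order_trans[OF lipschitz] mult_left_mono) auto
  finally show ?thesis .
qed

text \<open>The step of the mean is an exact step at \<open>y_mean k\<close> plus the error of
  evaluating each \<open>g i\<close> at \<open>x k i\<close> instead of at the mean.\<close>

lemma y_mean_error_Suc:
  assumes "k \<ge> 1"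
    and contraction: "\<And>u. norm (u - \<eta> *\<^sub>R ((\<Sum>i\<in>UNIV. g i u) /\<^sub>R CARD('v)) - z) \<le> r * norm (u - z)"
  shows "norm (y_mean (Suc k) - z) \<le> r * norm (y_mean k - z) + \<eta> * (K * spread (x k))"
proof -
  let ?d = "(\<Sum>i\<in>UNIV. g i (x k i) - g i (y_mean k)) /\<^sub>R CARD('v)"
  have "y_mean (Suc k) - z
      = (y_mean k - \<eta> *\<^sub>R ((\<Sum>i\<in>UNIV. g i (y_mean k)) /\<^sub>R CARD('v)) - z) - \<eta> *\<^sub>R ?d"
    unfolding y_mean_Suc s_mean_eq by (simp add: sum_subtractf algebra_simps)
  then have "norm (y_mean (Suc k) - z)
      \<le> norm (y_mean k - \<eta> *\<^sub>R ((\<Sum>i\<in>UNIV. g i (y_mean k)) /\<^sub>R CARD('v)) - z) + norm (\<eta> *\<^sub>R ?d)"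
    by (metis norm_triangle_ineq4)
  moreover have "norm ?d \<le> K * spread (x k)"
    using x_near_mean[OF assms(1)] K_nonneg
    by (intro norm_mean_le order_trans[OF lipschitz] mult_left_mono) auto
  then have "norm (\<eta> *\<^sub>R ?d) \<le> \<eta> * (K * spread (x k))"
    using \<eta>_pos by (simp only: norm_scaleR abs_of_pos mult_left_mono less_imp_le)
  ultimately show ?thesis using contraction[of "y_mean k"] by linarith
qed

text \<open>
  Small-gain argument: the weights \<open>(v1, 1, v3)\<close> make the nonnegative linear recursion for
  (optimality error, spread of \<open>x\<close>, spread of \<open>h\<close>) contract in a weighted maximum norm.
\<close>

lemma geometric_convergence:
  assumes stationary: "(\<Sum>i\<in>UNIV. g i z) = 0"
    and contraction: "\<And>u. norm (u - \<eta> *\<^sub>R ((\<Sum>i\<in>UNIV. g i u) /\<^sub>R CARD('v)) - z) \<le> r * norm (u - z)"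
    and r: "r \<ge> 0" and q: "q \<le> c0 ^ (2 * mixing_time + 1)" and v: "v1 > 0" "v3 > 0"
    and gain1: "r * v1 + \<eta> * K < v1"
    and gain2: "\<eta> * mixing_time * v3 < q"
    and gain3: "2 * winv * K * mixing_time * (1 + \<eta> * (v3 + K * (1 + v1))) < q * v3"
  shows "\<exists>\<theta> C. 0 < \<theta> \<and> \<theta> < 1 \<and> (\<forall>k\<ge>1. \<forall>i. norm (x k i - z) \<le> C * \<theta> ^ k)"
proof -
  let ?T = mixing_time
  \<comment> \<open>The index is shifted by one because the estimates hold from iteration 1
    on.\<close>
  define V where "V = (\<lambda>k. max (norm (y_mean (Suc k) - z) / v1)
    (max (spread (x (Suc k))) (spread (h (Suc k)) / v3)))"
  \<comment> \<open>Apart from \<open>1 / 2\<close>, which keeps \<open>\<gamma>\<close> positive,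
    the entries are the growth factors of the three weighted quantities.\<close>
  define \<gamma> where "\<gamma> = max (1 / 2) (max ((r * v1 + \<eta> * K) / v1) (max (1 - q + \<eta> * ?T * v3)
    (1 - q + 2 * winv * K * ?T * (1 + \<eta> * (v3 + K * (1 + v1))) / v3)))"
  have "c0 ^ (2 * ?T + 1) \<le> 1"
    using c0 c0_lt_1 by (intro power_le_one) auto
  then have q_le: "q \<le> 1" "1 - c0 ^ (2 * ?T + 1) \<le> 1 - q" using q by auto
  have \<gamma>: "0 < \<gamma>" "\<gamma> < 1"
    using gain1 gain2 gain3 v by (auto simp: \<gamma>_def field_simps)
  have \<gamma>_ge: "(r * v1 + \<eta> * K) / v1 \<le> \<gamma>" "1 - q + \<eta> * ?T * v3 \<le> \<gamma>"
    "1 - q + 2 * winv * K * ?T * (1 + \<eta> * (v3 + K * (1 + v1))) / v3 \<le> \<gamma>"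
    by (auto simp: \<gamma>_def)
  have step: "V (k + ?T) \<le> \<gamma> * C" if "\<And>l. l < ?T \<Longrightarrow> V (k + l) \<le> C" for k C
  proof -
    have P: "norm (y_mean (Suc k + l) - z) \<le> C * v1" and X: "spread (x (Suc k + l)) \<le> C"
      and H: "spread (h (Suc k + l)) \<le> C * v3" if "l < ?T" for l
      using \<open>\<And>l. l < ?T \<Longrightarrow> V (k + l) \<le> C\<close>[OF that] v by (simp_all add: V_def field_simps)
    have C: "C \<ge> 0" using X[OF mixing_time_pos] spread_nonneg order_trans by blast
    have opt: "norm (y_mean (Suc k + ?T) - z) \<le> \<gamma> * C * v1"
    proof -
      \<comment> \<open>The mean error contracts in every single step, so only the last step of the
        window is used.\<close>
      define n where "n = Suc k + (?T - 1)"
      have n: "n \<ge> 1" "Suc k + ?T = Suc n" "?T - 1 < ?T"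
        using mixing_time_pos by (auto simp: n_def)
      have "norm (y_mean (Suc n) - z) \<le> r * norm (y_mean n - z) + \<eta> * (K * spread (x n))"
        by (rule y_mean_error_Suc[OF n(1) contraction])
      also have "\<dots> \<le> r * (C * v1) + \<eta> * (K * C)"
        unfolding n_def using r \<eta>_pos K_nonneg P[OF n(3)] X[OF n(3)]
        by (intro add_mono mult_left_mono) auto
      also have "\<dots> = (r * v1 + \<eta> * K) / v1 * (C * v1)"
        using v by (simp add: field_simps)
      also have "\<dots> \<le> \<gamma> * (C * v1)"
        using \<gamma>_ge(1) C v by (intro mult_right_mono) auto
      finally show ?thesis using n(2) by (simp add: mult.assoc)
    qed
    have consensus: "spread (x (Suc k + ?T)) \<le> \<gamma> * C"
    proof -
      have "spread (x (Suc k + ?T)) \<le> (1 - c0 ^ (2 * ?T + 1)) * spread (x (Suc k))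
          + (\<Sum>l<?T. \<eta> * spread (h (Suc k + l)))"
        by (rule spread_x_window) simp
      also have "\<dots> \<le> (1 - q) * C + (\<Sum>l<?T. \<eta> * (C * v3))"
        using q_le \<eta>_pos X[OF mixing_time_pos] spread_nonneg
        by (intro add_mono mult_mono sum_mono mult_left_mono H) auto
      also have "\<dots> = (1 - q + \<eta> * ?T * v3) * C"
        by (simp add: algebra_simps)
      also have "\<dots> \<le> \<gamma> * C"
        by (intro mult_right_mono \<gamma>_ge C)
      finally show ?thesis .
    qed
    have tracking: "spread (h (Suc k + ?T)) \<le> \<gamma> * C * v3"
    proof -
      let ?c = "1 + \<eta> * (v3 + K * (1 + v1))"
      have bound: "spread (x (Suc k + l)) + \<eta> * (spread (h (Suc k + l)) + norm (s_mean (Suc k + l))) \<le> C * ?c"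
        if l: "l < ?T" for l
      proof -
        have "norm (s_mean (Suc k + l)) \<le> K * (C + C * v1)"
          by (rule order_trans[OF norm_s_mean_le[OF _ stationary]])
            (use X[OF l] P[OF l] K_nonneg in \<open>auto intro!: mult_left_mono add_mono\<close>)
        then have "spread (x (Suc k + l)) + \<eta> * (spread (h (Suc k + l)) + norm (s_mean (Suc k + l)))
            \<le> C + \<eta> * (C * v3 + K * (C + C * v1))"
          using X[OF l] H[OF l] \<eta>_pos by (intro add_mono mult_left_mono) auto
        then show ?thesis by (simp add: algebra_simps)
      qed
      have "spread (h (Suc k + ?T)) \<le> (1 - c0 ^ (2 * ?T + 1)) * spread (h (Suc k))
          + (\<Sum>l<?T. 2 * winv * K *
            (spread (x (Suc k + l)) + \<eta> * (spread (h (Suc k + l)) + norm (s_mean (Suc k + l)))))"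
        by (rule spread_h_window) simp
      also have "\<dots> \<le> (1 - q) * (C * v3) + (\<Sum>l<?T. 2 * winv * K * (C * ?c))"
        using q_le winv_pos K_nonneg H[OF mixing_time_pos] spread_nonneg
        by (intro add_mono mult_mono[of "1 - c0 ^ (2 * ?T + 1)"] sum_mono mult_left_mono bound) auto
      also have "\<dots> = (1 - q + 2 * winv * K * ?T * ?c / v3) * (C * v3)"
        using v by (simp add: field_simps)
      also have "\<dots> \<le> \<gamma> * (C * v3)"
        using \<gamma>_ge(3) C v by (intro mult_right_mono) auto
      finally show ?thesis by (simp add: mult.assoc)
    qed
    show ?thesis
      using opt consensus tracking v by (simp add: V_def field_simps)
  qed
  have "\<exists>\<theta> C. 0 < \<theta> \<and> \<theta> < 1 \<and> (\<forall>k. V k \<le> C * \<theta> ^ k)"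
    by (rule windowed_contraction_imp_geometric[where T = ?T and \<gamma> = \<gamma>])
      (use mixing_time_pos \<gamma> step in auto)
  then obtain \<theta> C where \<theta>: "0 < \<theta>" "\<theta> < 1" and V_le: "\<And>k. V k \<le> C * \<theta> ^ k" by blast
  have "norm (x k i - z) \<le> (C * (1 + v1) / \<theta>) * \<theta> ^ k" if "k \<ge> 1" for k i
  proof -
    obtain n where n: "k = Suc n" using \<open>k \<ge> 1\<close> by (cases k) auto
    have "spread (x k) \<le> C * \<theta> ^ n" "norm (y_mean k - z) \<le> C * \<theta> ^ n * v1"
      using V_le[of n] v by (simp_all add: V_def n field_simps)
    then have "norm (x k i - z) \<le> C * \<theta> ^ n + C * \<theta> ^ n * v1"
      using norm_x_diff_le[OF \<open>k \<ge> 1\<close>, of i z] by linarith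
    also have "\<dots> = (C * (1 + v1) / \<theta>) * \<theta> ^ k"
      using \<theta> by (simp add: n field_simps)
    finally show ?thesis .
  qed
  then show ?thesis using \<theta> by blast
qed

end

subsection \<open>Convergence rate\<close>

text \<open>The claim reduces to comparing the square root with \<open>1 + c - e\<close>; the
  squares differ by \<open>(1 - e)^2 * (1 + c)\<close>, which is positive.\<close>

lemma rate_bound_lt_1:
  fixes c e :: real
  assumes "0 < n" "0 \<le> e" "e < 1" "0 < c"
  shows "root n ((e + sqrt (c * (c - e\<^sup>2 + 1))) / (1 + c)) < 1"
proof -
  have "(1 - e) * (1 + e) * c < (1 - e) * 2 * c"
    using assms by (intro mult_strict_right_mono mult_strict_left_mono) auto
  then have "c * (c - e\<^sup>2 + 1) < (1 + c - e)\<^sup>2"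
    using zero_le_power2[of "1 - e"] by (simp add: power2_eq_square algebra_simps)
  then have "sqrt (c * (c - e\<^sup>2 + 1)) < 1 + c - e"
    using assms by (intro real_less_lsqrt) auto
  then have "(e + sqrt (c * (c - e\<^sup>2 + 1))) / (1 + c) < 1"
    using assms by simp
  then show ?thesis using assms by simp
qed

text \<open>
  With the weights \<open>v1 = 3 \<kappa>\<close> and \<open>v3 = q / (2 \<eta> T)\<close> the first two small-gain conditions hold with room
  to spare, so only the third one, below, restricts the step size.
\<close>

lemma step_size_gain_bounds:
  fixes \<eta> K \<kappa> Wi C T q Y :: real
  assumes pos: "\<eta> > 0" "K > 0" "\<kappa> > 0" and Wi: "Wi \<ge> 1"
    and q: "0 < q" "q \<le> 1" and T: "T \<ge> 1"
    and C: "C \<ge> 0" "C\<^sup>2 \<ge> 4 * \<kappa>" and Y: "Y \<ge> 2 * (T / q)"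
    and step: "2 * Y\<^sup>2 * (\<eta> * K) * Wi * (1 + C) < 1"
  shows "\<eta> * K \<le> 1 / 2"
    and "2 * Wi * K * T * (1 + \<eta> * (q / (2 * \<eta> * T) + K * (1 + 3 * \<kappa>))) < q * (q / (2 * \<eta> * T))"
proof -
  define Z where "Z = T / q"
  \<comment> \<open>The normalized step size: since \<open>Y\<close> is at least
    \<open>2 * Z\<close>, the step condition becomes \<open>8 * N * (1 + C) < 1\<close>.\<close>
  define N where "N = \<eta> * K * Wi * Z\<^sup>2"
  have Z: "Z \<ge> 1" using q T by (simp add: Z_def)
  have "(2 * Z)\<^sup>2 \<le> Y\<^sup>2" using Y Z by (intro power_mono) (auto simp: Z_def)
  then have "2 * (2 * Z)\<^sup>2 * (\<eta> * K) * Wi * (1 + C) \<le> 2 * Y\<^sup>2 * (\<eta> * K) * Wi * (1 + C)"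
    using pos Wi C by (intro mult_right_mono) auto
  then have N: "8 * N * (1 + C) < 1"
    using step by (simp add: N_def power_mult_distrib mult_ac)
  have "\<eta> * K * 1 * 1 \<le> \<eta> * K * Wi * Z\<^sup>2"
    using pos Wi Z one_le_power[of Z 2] by (intro mult_mono) auto
  then have \<eta>K: "\<eta> * K \<le> N" by (simp add: N_def)
  have N_pos: "N > 0" using pos \<eta>K by (meson less_le_trans mult_pos_pos)
  have "8 * N * 1 \<le> 8 * N * (1 + C)" using N_pos C by (intro mult_left_mono) auto
  then have N8: "N < 1 / 8" using N by linarith
  then show "\<eta> * K \<le> 1 / 2" using \<eta>K by linarith
  \<comment> \<open>The condition number is absorbed by \<open>(1 + C)\<close> squared, so the
    product is controlled by the square of \<open>N * (1 + C)\<close>.\<close>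
  have "\<eta> * K * (1 + 3 * \<kappa>) * N \<le> N * (1 + C)\<^sup>2 * N"
  proof (intro mult_right_mono mult_mono)
    show "1 + 3 * \<kappa> \<le> (1 + C)\<^sup>2"
      using C pos unfolding power2_sum by simp
  qed (use N_pos \<eta>K pos in auto)
  also have "\<dots> = (N * (1 + C))\<^sup>2" by (simp add: power2_eq_square mult_ac)
  also have "\<dots> \<le> (1 / 8)\<^sup>2" using N N_pos C by (intro power_mono) auto
  finally have quad: "\<eta> * K * (1 + 3 * \<kappa>) * N \<le> 1 / 64" by (simp add: power2_eq_square)
  have "N / (2 * Z) \<le> N / 2" using Z N_pos by (simp add: field_simps)
  \<comment> \<open>The three summands are below 1/2, below 1/4 and at most 1/16.\<close>
  then have key: "4 * N * (1 + 1 / (2 * Z) + \<eta> * K * (1 + 3 * \<kappa>)) < 1"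
    using quad N8 by (simp add: algebra_simps)
  have T_eq: "T = q * Z" using q by (simp add: Z_def)
  have "Z \<noteq> 0" "q \<noteq> 0" "\<eta> \<noteq> 0" using Z q pos by auto
  have nz: "Z \<noteq> 0" "q \<noteq> 0" "\<eta> \<noteq> 0" using Z q pos by auto
  define S where "S = 1 + 1 / (2 * Z) + \<eta> * K * (1 + 3 * \<kappa>)"
  have r: "q / (2 * \<eta> * T) = 1 / (2 * \<eta> * Z)"
    using nz by (simp add: T_eq)
  have "1 + \<eta> * (1 / (2 * \<eta> * Z) + K * (1 + 3 * \<kappa>)) = S"
    using nz by (simp add: S_def distrib_left)
  then have "2 * Wi * K * T * (1 + \<eta> * (q / (2 * \<eta> * T) + K * (1 + 3 * \<kappa>))) = 2 * Wi * K * (q * Z) * S"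
    unfolding r by (simp add: T_eq)
  \<comment> \<open>The ratio of the two sides of the third gain condition is exactly
    \<open>4 * N * S\<close>.\<close>
  also have "\<dots> = (4 * N * S) * (q * (q / (2 * \<eta> * T)))"
    unfolding r N_def using nz by (simp add: field_simps power2_eq_square)
  also have "\<dots> < 1 * (q * (q / (2 * \<eta> * T)))"
    using q pos T by (intro mult_strict_right_mono key[folded S_def]) auto
  finally show "2 * Wi * K * T * (1 + \<eta> * (q / (2 * \<eta> * T) + K * (1 + 3 * \<kappa>))) < q * (q / (2 * \<eta> * T))"
    by simp
qed

theorem theorem1:
  fixes f :: "'v::finite \<Rightarrow> real^'d \<Rightarrow> real"
    and L \<mu> :: "'v \<Rightarrow> real"
    and E :: "nat \<Rightarrow> ('v \<times> 'v) set"
    and a :: "nat \<Rightarrow> real^'v^'v"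
    and x y s :: "nat \<Rightarrow> real^'d^'v"
    and w :: "nat \<Rightarrow> real^'v"
    and xstar :: "real^'d"
    and m Bt B B0 :: nat
    and c0 \<alpha> \<beta> \<eta> Lhat Lbar \<mu>hat \<mu>bar \<kappa> \<sigma> \<epsilon> \<epsilon>' Winv C1 C2 \<theta>0 :: real
  assumes m: "m = CARD('v)"
    and diff: "\<And>i z. f i differentiable (at z)"
    and L_pos: "\<And>i. L i > 0"
    and smooth: "\<And>i. smooth_with (L i) (f i)"
    and \<mu>_nonneg: "\<And>i. \<mu> i \<ge> 0"
    and \<mu>_sum: "(\<Sum>i\<in>UNIV. \<mu> i) > 0"
    and convex: "\<And>i. strongly_convex_with (\<mu> i) (f i)"
    and Bt_pos: "Bt > 0"
    and connected: "uniformly_strongly_connected Bt E"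
    and c0: "0 < c0" "c0 < 1 / real m"
    and weights: "weight_rule c0 E a"
    and run: "algorithm_run f a \<eta> x y w s"
    and minimizer: "is_arg_min (\<lambda>z. (1 / real m) * (\<Sum>i\<in>UNIV. f i z)) (\<lambda>_. True) xstar"
    and \<alpha>: "\<alpha> > 0" and \<beta>: "\<beta> > 0"
    and Lhat: "Lhat = Max (range L)"
    and Lbar: "Lbar = (1 / real m) * (\<Sum>i\<in>UNIV. L i)"
    and \<mu>hat: "\<mu>hat = Max (range \<mu>)"
    and \<mu>bar: "\<mu>bar = (1 / real m) * (\<Sum>i\<in>UNIV. \<mu> i)"
    and \<kappa>: "\<kappa> = Lhat / \<mu>bar"
    and B: "B = 2 * Bt - 1"
    and \<sigma>: "\<sigma> = c0 ^ (2 + m * B)"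
    and \<epsilon>: "\<epsilon> = 2 * real m * ((1 + inverse (\<sigma> ^ (m * B))) / (1 - \<sigma> ^ (m * B)))"
    and B0: "B0 \<ge> B"
    and \<epsilon>': "\<epsilon>' = \<epsilon> * (1 - \<sigma> ^ (m * B)) powr ((real B0 - 1) / real (m * B))"
    and \<epsilon>'_less: "\<epsilon>' < 1"
    and C1: "C1 = 2 * sqrt ((1 + \<beta>) * real m * Lhat / (\<beta> * \<mu>bar) + \<alpha> * real m * \<mu>hat / \<mu>bar)"
    and Winv: "Winv = (SUP k\<in>{1..}. max_norm (matrix_inv (diag_mat (w k))))"
    and C2: "C2 = 2 * real B0 * \<kappa> * \<epsilon> * Winv * (\<epsilon>' + \<epsilon> * (real B0 - 1))
                  * (1 + sqrt (real m)) * (1 + inverse \<alpha>) * (1 + C1)"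
    and \<theta>0: "\<theta>0 = root B0 ((\<epsilon>' + sqrt (C2 * (C2 - \<epsilon>'\<^sup>2 + 1))) / (1 + C2))"
    and \<eta>: "\<eta> \<in> {0<..<min ((1 + inverse \<alpha>) * (1 - \<epsilon>')\<^sup>2 / (\<mu>bar * C2)) (1 / ((1 + \<beta>) * Lbar))}"
  shows "\<exists>\<theta> C. \<theta>0 \<le> \<theta> \<and> \<theta> < 1 \<and>
           (\<forall>k\<ge>1. frobenius_norm (x k - (\<chi> i. xstar)) \<le> C * \<theta> ^ k)"
proof -
  define g where "g = (\<lambda>i. gradient (f i))"
  define F where "F = (\<lambda>z. (1 / real m) * (\<Sum>i\<in>UNIV. f i z))"
  define G where "G = (\<lambda>z. (\<Sum>i\<in>UNIV. g i z) /\<^sub>R m)"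
  have m_pos: "m > 0" by (simp add: m)

  \<comment> \<open>Regularity of the averaged objective\<close>
  have L_le: "L i \<le> Lhat" for i by (simp add: Lhat)
  have Lhat_pos: "Lhat > 0" using L_pos L_le less_le_trans by blast
  have \<mu>bar_pos: "\<mu>bar > 0" using \<mu>_sum m_pos by (simp add: \<mu>bar)
  have \<mu>hat_nonneg: "\<mu>hat \<ge> 0"
    using \<mu>_nonneg[of undefined] by (auto simp: \<mu>hat intro: order_trans[OF _ Max_ge])
  have lipschitz: "norm (g i u - g i v) \<le> Lhat * norm (u - v)" for i u v
  proof -
    have "norm (g i u - g i v) \<le> L i * norm (u - v)"
      using smooth[of i] by (simp add: smooth_with_def g_def)
    also have "\<dots> \<le> Lhat * norm (u - v)" by (intro mult_right_mono L_le) simp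
    finally show ?thesis .
  qed
  have F_convex: "F v \<ge> F u + G u \<bullet> (v - u) + \<mu>bar / 2 * (norm (v - u))\<^sup>2" for u v
  proof -
    have "(\<Sum>i\<in>UNIV. f i u + g i u \<bullet> (v - u) + \<mu> i / 2 * (norm (v - u))\<^sup>2) \<le> (\<Sum>i\<in>UNIV. f i v)"
      using convex by (intro sum_mono) (simp add: strongly_convex_with_def g_def)
    then have "(1 / real m) * (\<Sum>i\<in>UNIV. f i u + g i u \<bullet> (v - u) + \<mu> i / 2 * (norm (v - u))\<^sup>2)
        \<le> (1 / real m) * (\<Sum>i\<in>UNIV. f i v)"
      by (intro mult_left_mono) auto
    then show ?thesis
      by (simp add: F_def G_def \<mu>bar sum.distrib inner_sum_left sum_distrib_right[symmetric]
          sum_divide_distrib[symmetric] add_divide_distrib inverse_eq_divide)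
  qed
  have G_lipschitz: "norm (G u - G v) \<le> Lhat * norm (u - v)" for u v
  proof -
    have "norm (\<Sum>i\<in>UNIV. g i u - g i v) \<le> m * (Lhat * norm (u - v))"
      unfolding m using lipschitz by (intro sum_norm_bound) auto
    then show ?thesis
      using m_pos by (simp add: G_def scaleR_diff_right[symmetric] sum_subtractf[symmetric] field_simps)
  qed
  have F_min: "F xstar \<le> F u" for u
    using minimizer by (auto simp: is_arg_min_def F_def not_less)
  \<comment> \<open>The space contains two distinct points, as comparing the moduli
    requires.\<close>
  have "(axis undefined 1 :: real^'d) \<noteq> 0" by (simp add: axis_eq_0_iff)
  then have \<mu>bar_le: "\<mu>bar \<le> Lhat"
    using strong_convexity_modulus_le_smoothness[of F G \<mu>bar Lhat, OF F_convex G_lipschitz] by blast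
  have "F v \<ge> F u + G u \<bullet> (v - u)" for u v
    by (rule order_trans[OF _ F_convex[where u = u]]) (use \<mu>bar_pos in simp)
  \<comment> \<open>At the minimizer the gap is zero, so the gradient bound itself yields
    stationarity.\<close>
  then have "(norm (G xstar))\<^sup>2 \<le> 4 * Lhat * (F xstar - F xstar)"
    using G_lipschitz F_min Lhat_pos by (rule norm_gradient_le_gap)
  then have stationary: "(\<Sum>i\<in>UNIV. g i xstar) = 0"
    using m_pos by (simp add: G_def)

  \<comment> \<open>Instantiating the mixing and tracking estimates\<close>
  have \<eta>_pos: "\<eta> > 0" using \<eta> by simp
  interpret push_sum c0 E Bt a w
    using c0 connected weights run by unfold_locales (auto simp: m algorithm_run_def)
  have T_eq: "mixing_time = m * B" by (simp add: mixing_time_def m B)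
  have Winv_ge: "inverse (w k $ i) \<le> Winv" if "k \<ge> 1" for k i
    unfolding Winv by (rule inverse_w_le_SUP[OF that])
  interpret gradient_tracking c0 E Bt a w g "\<lambda>k. ($) (x k)" "\<lambda>k. ($) (y k)" "\<lambda>k. ($) (s k)" \<eta> Lhat Winv
  proof unfold_locales
    show "x k $ i = y k $ i /\<^sub>R w k $ i" if "k \<ge> 1" for k i
      using run that by (cases k) (auto simp: algorithm_run_def)
  qed (use run lipschitz Lhat_pos Winv_ge \<eta>_pos in \<open>auto simp: algorithm_run_def g_def\<close>)
  have Winv_ge_1: "Winv \<ge> 1" using Winv_ge[of 1 undefined] w_1 by simp

  \<comment> \<open>Comparing the constants with the contraction of a window\<close>
  define q where "q = \<sigma> ^ (m * B)"
  have B_pos: "B > 0" using mixing_time_pos by (simp add: T_eq)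
  have T_ge: "real (m * B) \<ge> 1" using mixing_time_pos by (simp only: T_eq[symmetric] real_of_nat_ge_one_iff Suc_leI One_nat_def)
  have "\<sigma> > 0" "\<sigma> < 1"
    using c0 c0_lt_1 power_Suc_less_one[of c0 "Suc (m * B)"] by (simp_all add: \<sigma>)
  then have q: "0 < q" "q < 1"
    using mixing_time_pos power_strict_decreasing[of 0 "m * B" \<sigma>] unfolding T_eq by (simp_all add: q_def)
  \<comment> \<open>With \<open>T = m * B\<close>, the exponent of \<open>c0\<close> in
    \<open>q\<close> is \<open>(2 + T) * T\<close>, which is at least
    \<open>2 * T + 1\<close>.\<close>
  have q_le: "q \<le> c0 ^ (2 * mixing_time + 1)"
  proof -
    have "1 * 1 \<le> (m * B) * (m * B)" using m_pos B_pos by (intro mult_le_mono) (auto simp: Suc_le_eq)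
    then have "2 * (m * B) + 1 \<le> (2 + m * B) * (m * B)" by (simp add: algebra_simps)
    then show ?thesis
      unfolding q_def \<sigma> T_eq power_mult[symmetric] using c0 c0_lt_1 by (intro power_decreasing) auto
  qed
  have \<epsilon>_ge: "\<epsilon> \<ge> 2 * real m / q"
  proof -
    have "1 / q \<le> (1 + 1 / q) / (1 - q)"
      using q by (simp add: field_simps)
    then have "2 * real m * (1 / q) \<le> 2 * real m * ((1 + 1 / q) / (1 - q))"
      by (intro mult_left_mono) auto
    then show ?thesis by (simp add: \<epsilon> q_def inverse_eq_divide)
  qed
  moreover have "2 * real m / q \<ge> 2 * 1 / 1"
    using q m_pos by (intro frac_le) auto
  ultimately have \<epsilon>_ge_2: "\<epsilon> \<ge> 2" by simp
  have \<epsilon>'_nonneg: "\<epsilon>' \<ge> 0" using \<epsilon>_ge_2 by (simp add: \<epsilon>')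
  \<comment> \<open>For \<open>B0 = 1\<close> the exponent in \<open>\<epsilon>'\<close> vanishes,
    so \<open>\<epsilon>' = \<epsilon> \<ge> 2\<close>, against
    \<open>\<epsilon>' < 1\<close>.\<close>
  have B0_ge: "B0 \<ge> 2"
  proof (rule ccontr)
    assume "\<not> B0 \<ge> 2"
    moreover have "B0 \<ge> 1" using B0 B_pos by simp
    ultimately have "B0 = 1" by simp
    then have "\<epsilon>' = \<epsilon>" using q by (simp add: \<epsilon>' q_def)
    then show False using \<epsilon>'_less \<epsilon>_ge_2 by simp
  qed

  \<comment> \<open>Normalizing the step-size condition\<close>
  define Y where "Y = real B0 * \<epsilon>"
  have Y_ge: "Y \<ge> 2 * (real (m * B) / q)"
  proof -
    have "real B * (2 * real m / q) \<le> real B0 * \<epsilon>"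
      using B0 \<epsilon>_ge \<epsilon>_ge_2 q by (intro mult_mono) auto
    then show ?thesis by (simp add: Y_def mult_ac)
  qed
  have \<kappa>_pos: "\<kappa> > 0" using Lhat_pos \<mu>bar_pos by (simp add: \<kappa>)
  have C1_nonneg: "C1 \<ge> 0" and C1_ge: "C1\<^sup>2 \<ge> 4 * \<kappa>"
  proof -
    let ?R = "(1 + \<beta>) * real m * Lhat / (\<beta> * \<mu>bar) + \<alpha> * real m * \<mu>hat / \<mu>bar"
    have "1 \<le> (1 + \<beta>) / \<beta> * real m"
      using \<beta> m_pos mult_mono[of 1 "(1 + \<beta>) / \<beta>" 1 "real m"] by simp
    then have "1 * \<kappa> \<le> ((1 + \<beta>) / \<beta> * real m) * \<kappa>"
      using \<kappa>_pos by (intro mult_right_mono) auto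
    also have "\<dots> = (1 + \<beta>) * real m * Lhat / (\<beta> * \<mu>bar)"
      by (simp add: \<kappa>)
    also have "\<dots> \<le> ?R"
      using \<alpha> \<mu>hat_nonneg \<mu>bar_pos by simp
    finally have R: "\<kappa> \<le> ?R" by simp
    then have "?R \<ge> 0" using \<kappa>_pos by linarith
    then show "C1 \<ge> 0" "C1\<^sup>2 \<ge> 4 * \<kappa>"
      using R by (simp_all add: C1 power_mult_distrib)
  qed
  have step: "2 * Y\<^sup>2 * (\<eta> * Lhat) * Winv * (1 + C1) < 1" and C2_pos: "C2 > 0"
  proof -
    let ?D = "\<epsilon>' + \<epsilon> * (real B0 - 1)"
    \<comment> \<open>This is \<open>C2\<close> without \<open>1 + inverse \<alpha>\<close>, which
      cancels against the same factor in the bound on \<open>\<eta>\<close>.\<close>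
    let ?A = "2 * real B0 * \<kappa> * \<epsilon> * Winv * ?D * (1 + sqrt (real m)) * (1 + C1)"
    \<comment> \<open>Since \<open>B0 \<ge> 2\<close>, \<open>?D\<close> is at least half of
      \<open>Y\<close>; this produces the second factor \<open>Y\<close>.\<close>
    have "\<epsilon> * (real B0 / 2) \<le> \<epsilon> * (real B0 - 1)"
      using B0_ge \<epsilon>_ge_2 by (intro mult_left_mono) auto
    then have D: "Y / 2 \<le> ?D" using \<epsilon>'_nonneg by (simp add: Y_def mult.commute)
    have Y_pos: "Y > 0" using \<epsilon>_ge_2 B0_ge by (simp add: Y_def)
    have "1 \<le> sqrt (real m)" using m_pos by simp
    then have "2 * \<kappa> * Y * Winv * (Y / 2) * 2 * (1 + C1)
        \<le> 2 * \<kappa> * Y * Winv * ?D * (1 + sqrt (real m)) * (1 + C1)"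
      using \<kappa>_pos Y_pos Winv_ge_1 C1_nonneg D by (intro mult_mono mult_nonneg_nonneg) auto
    then have A: "2 * Y\<^sup>2 * \<kappa> * Winv * (1 + C1) \<le> ?A"
      by (simp add: Y_def power2_eq_square mult_ac)
    have "0 < 2 * Y\<^sup>2 * \<kappa> * Winv * (1 + C1)"
      using Y_pos \<kappa>_pos Winv_ge_1 C1_nonneg by (intro mult_pos_pos) auto
    with A have A_pos: "?A > 0" by linarith
    have C2_eq: "C2 = ?A * (1 + inverse \<alpha>)" by (simp add: C2 mult_ac)
    have \<alpha>': "1 + inverse \<alpha> > 0" using \<alpha> by (simp add: add_pos_pos)
    then show "C2 > 0" using A_pos C2_eq by simp
    have "(1 - \<epsilon>')\<^sup>2 \<le> 1"
      using \<epsilon>'_nonneg \<epsilon>'_less by (intro power_le_one) auto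
    have "\<eta> < (1 + inverse \<alpha>) * (1 - \<epsilon>')\<^sup>2 / (\<mu>bar * C2)" using \<eta> by simp
    then have "\<eta> * (\<mu>bar * C2) < (1 + inverse \<alpha>) * (1 - \<epsilon>')\<^sup>2"
      using \<mu>bar_pos \<open>C2 > 0\<close> by (simp add: pos_less_divide_eq)
    also have "\<dots> \<le> (1 + inverse \<alpha>) * 1"
      using \<alpha>' \<open>(1 - \<epsilon>')\<^sup>2 \<le> 1\<close> by (intro mult_left_mono) auto
    finally have "(1 + inverse \<alpha>) * (\<eta> * \<mu>bar * ?A) < (1 + inverse \<alpha>) * 1"
      unfolding C2_eq by (simp only: mult_ac)
    then have "\<eta> * \<mu>bar * ?A < 1" using \<alpha>' by (simp only: mult_less_cancel_left_pos)
    moreover have "\<eta> * \<mu>bar * (2 * Y\<^sup>2 * \<kappa> * Winv * (1 + C1)) \<le> \<eta> * \<mu>bar * ?A"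
      using A \<eta>_pos \<mu>bar_pos by (intro mult_left_mono) auto
    ultimately have "\<eta> * \<mu>bar * (2 * Y\<^sup>2 * \<kappa> * Winv * (1 + C1)) < 1" by linarith
    moreover have "Lhat = \<mu>bar * \<kappa>" using \<mu>bar_pos by (simp add: \<kappa>)
    ultimately show "2 * Y\<^sup>2 * (\<eta> * Lhat) * Winv * (1 + C1) < 1"
      by (simp add: mult_ac)
  qed
  note gains = step_size_gain_bounds[OF \<eta>_pos Lhat_pos \<kappa>_pos Winv_ge_1 q(1) less_imp_le[OF q(2)] T_ge
      C1_nonneg C1_ge Y_ge step]

  \<comment> \<open>Verifying the small-gain conditions\<close>
  let ?r = "1 - \<eta> * \<mu>bar / 2" and ?v1 = "3 * \<kappa>" and ?v3 = "q / (2 * \<eta> * real (m * B))"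
  have "\<eta> * \<mu>bar \<le> \<eta> * Lhat" using \<mu>bar_le \<eta>_pos by simp
  then have r: "?r \<ge> 0" using gains(1) by linarith
  have contraction: "norm (u - \<eta> *\<^sub>R ((\<Sum>i\<in>UNIV. g i u) /\<^sub>R CARD('v)) - xstar) \<le> ?r * norm (u - xstar)" for u
    using gradient_step_contracts[of F G \<mu>bar Lhat xstar \<eta> u, OF F_convex G_lipschitz F_min]
      \<mu>bar_pos \<mu>bar_le Lhat_pos \<eta>_pos gains(1) by (simp add: G_def m)
  have "\<exists>\<theta> C. 0 < \<theta> \<and> \<theta> < 1 \<and> (\<forall>k\<ge>1. \<forall>i. norm (x k $ i - xstar) \<le> C * \<theta> ^ k)"
  proof (rule geometric_convergence[OF stationary contraction r q_le])
    show "?v1 > 0" "?v3 > 0" using \<kappa>_pos q \<eta>_pos T_ge by auto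
    \<comment> \<open>With \<open>?v1 = 3 * \<kappa>\<close> the contraction gains
      \<open>3 / 2 * \<eta> * Lhat\<close>, more than the perturbation
      \<open>\<eta> * Lhat\<close>.\<close>
    have Lhat_eq: "Lhat = \<mu>bar * \<kappa>" using \<mu>bar_pos by (simp add: \<kappa>)
    have "\<eta> * (\<mu>bar * \<kappa>) > 0" using \<eta>_pos \<mu>bar_pos \<kappa>_pos by simp
    then show "?r * ?v1 + \<eta> * Lhat < ?v1" unfolding Lhat_eq by (simp add: algebra_simps)
    show "\<eta> * real mixing_time * ?v3 < q"
      using \<eta>_pos q T_ge by (simp add: T_eq)
    show "2 * Winv * Lhat * real mixing_time * (1 + \<eta> * (?v3 + Lhat * (1 + ?v1))) < q * ?v3"
      using gains(2) by (simp only: T_eq)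
  qed

  \<comment> \<open>Rate in the Frobenius norm\<close>
  then obtain \<theta> C where \<theta>: "0 < \<theta>" "\<theta> < 1"
    and bound: "\<And>k i. k \<ge> 1 \<Longrightarrow> norm (x k $ i - xstar) \<le> C * \<theta> ^ k" by blast
  have C: "C \<ge> 0"
    using order_trans[OF norm_ge_zero bound[of 1 undefined]] \<theta> by (simp add: zero_le_mult_iff)
  have \<theta>0_lt: "\<theta>0 < 1"
    unfolding \<theta>0 using B0_ge \<epsilon>'_nonneg \<epsilon>'_less C2_pos by (intro rate_bound_lt_1) auto
  show ?thesis
  proof (intro exI conjI allI impI)
    \<comment> \<open>Enlarging the obtained rate to \<open>max \<theta>0 \<theta>\<close> meets the
      lower bound \<open>\<theta>0\<close> and stays below 1.\<close>
    show "\<theta>0 \<le> max \<theta>0 \<theta>" "max \<theta>0 \<theta> < 1" using \<theta>0_lt \<theta> by auto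
    fix k :: nat assume "k \<ge> 1"
    have "frobenius_norm (x k - (\<chi> i. xstar)) \<le> (\<Sum>i\<in>UNIV. norm ((x k - (\<chi> i. xstar)) $ i))"
      unfolding frobenius_norm_eq_norm norm_vec_def by (rule L2_set_le_sum) simp
    also have "\<dots> \<le> (\<Sum>i\<in>(UNIV :: 'v set). C * max \<theta>0 \<theta> ^ k)"
    proof (rule sum_mono)
      fix i
      have "norm (x k $ i - xstar) \<le> C * \<theta> ^ k" by (rule bound[OF \<open>k \<ge> 1\<close>])
      also have "\<dots> \<le> C * max \<theta>0 \<theta> ^ k" using C \<theta> by (intro mult_left_mono power_mono) auto
      finally show "norm ((x k - (\<chi> i. xstar)) $ i) \<le> C * max \<theta>0 \<theta> ^ k" by simp
    qed
    finally show "frobenius_norm (x k - (\<chi> i. xstar)) \<le> (real m * C) * max \<theta>0 \<theta> ^ k"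
      by (simp add: m)
  qed
qed

end
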